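(* Let $A$ be a Banach algebra, let $n\ge 0$ be an even integer, and let $T,S:A^{(n)}\to A^{(n)}$ be continuous linear mappings. Assume that $A^{(n+2)}$ has the $T$-$w^*w$ property. If $A^{(n+2)}$ is weakly $T''$-$S''$-amenable, then $A^{(n)}$ is weakly $T$-$S$-amenable.
   Context: Notation: $A^{(n)}$ is the $n$-th dual of $A$, with $A^{(0)}=A$. For a Banach algebra $B$, the dual $B^*$ is a Banach $B$-bimodule via $\langle a'a,b\rangle=\langle a',ab\rangle$ and $\langle aa',b\rangle=\langle a',ba\rangle$ ($a,b\in B$, $a'\in B^*$). The second dual $B^{**}$ is a Banach algebra under the first Arens product: $\langle b''a',a\rangle=\langle b'',a'a\rangle$ and $\langle a''b'',a'\rangle=\langle a'',b''a'\rangle$ ($a\in B$, $a'\in B^*$, $a'',b''\in B^{**}$). For even $n$, $A^{(n+2)}=(A^{(n)})^{**}$ is given the first Arens product inductively, and $A^{(n+1)}$ is the dual $A^{(n)}$-bimodule of $A^{(n)}$. $T''$ denotes the second adjoint of $T$. Definitions: Let $B$ be a Banach algebra, $X$ a Banach $B$-bimodule, and $T,S:B\to B$ continuous linear maps. A bounded linear map $D:B\to X$ is a $T$-$S$-derivation if $D(xy)=T(x)D(y)+D(x)S(y)$ for all $x,y\in B$. It is an inner $T$-$S$-derivation if there is $x\in X$ with $D(a)=T(a)x-xS(a)$ for all $a\in B$. $B$ is weakly $T$-$S$-amenable if every $T$-$S$-derivation from $B$ into $B^*$ is an inner $T$-$S$-derivation. For a continuous linear map $T:B\to B$, $B^{**}$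 has the $T$-$w^*w$ property if for every $a''\in B^{**}$ the map $b''\mapsto a''T''(b'')$, $B^{**}\to B^{**}$, is weak$^*$-to-weak continuous; "$A^{(n+2)}$ has the $T$-$w^*w$ property" is this with $B=A^{(n)}$. *)

theory Defs
  imports "HOL-Analysis.Analysis" "HOL-Library.Function_Algebras"
begin

text \<open>
  All spaces are carrier-based, because the number \<open>n\<close> of dualisations is a natural number, so that
  the iterated duals cannot be given as types.  A space is a subset of an ambient abelian group
  \<open>'v\<close> together with a scalar multiplication and a norm; nothing is required outside the subset.
  The scalar field \<open>'k\<close> is any complete real normed field, which covers both the real and the
  complex numbers.  A functional is a function that is \<open>0\<close> outside the space on which it lives,
  so that the dual of a space on \<open>'v\<close> is a space on \<open>'v \<Rightarrow> 'k\<close>, with pointwise addition.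
\<close>

record ('k, 'v) nspace =
  carrier :: "'v set"
  smul :: "'k \<Rightarrow> 'v \<Rightarrow> 'v"
  nrm :: "'v \<Rightarrow> real"

record ('k, 'v) nalgebra = "('k, 'v) nspace" +
  mul :: "'v \<Rightarrow> 'v \<Rightarrow> 'v"

record ('k, 'b, 'v) nbimodule = "('k, 'v) nspace" +
  lact :: "'b \<Rightarrow> 'v \<Rightarrow> 'v"
  ract :: "'v \<Rightarrow> 'b \<Rightarrow> 'v"

locale banach_space =
  fixes X :: "('k::{real_normed_field,banach}, 'v::ab_group_add, 'm) nspace_scheme"
  assumes zero_closed: "0 \<in> carrier X"
    and add_closed: "\<lbrakk>x \<in> carrier X; y \<in> carrier X\<rbrakk> \<Longrightarrow> x + y \<in> carrier X"
    and smul_closed: "x \<in> carrier X \<Longrightarrow> smul X c x \<in> carrier X"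
    and smul_add_right: "\<lbrakk>x \<in> carrier X; y \<in> carrier X\<rbrakk> \<Longrightarrow> smul X c (x + y) = smul X c x + smul X c y"
    and smul_add_left: "x \<in> carrier X \<Longrightarrow> smul X (c + d) x = smul X c x + smul X d x"
    and smul_smul: "x \<in> carrier X \<Longrightarrow> smul X c (smul X d x) = smul X (c * d) x"
    and smul_one: "x \<in> carrier X \<Longrightarrow> smul X 1 x = x"
    and nrm_eq_zero_iff: "x \<in> carrier X \<Longrightarrow> nrm X x = 0 \<longleftrightarrow> x = 0"
    and nrm_triangle: "\<lbrakk>x \<in> carrier X; y \<in> carrier X\<rbrakk> \<Longrightarrow> nrm X (x + y) \<le> nrm X x + nrm X y"
    and nrm_smul: "x \<in> carrier X \<Longrightarrow> nrm X (smul X c x) = norm c * nrm X x"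
    and complete: "\<lbrakk>\<And>i. \<sigma> i \<in> carrier X;
        \<And>e. e > 0 \<Longrightarrow> \<exists>N. \<forall>i\<ge>N. \<forall>j\<ge>N. nrm X (\<sigma> i - \<sigma> j) < e\<rbrakk>
        \<Longrightarrow> \<exists>x\<in>carrier X. (\<lambda>i. nrm X (\<sigma> i - x)) \<longlonglongrightarrow> 0"

locale banach_algebra = banach_space B
  for B :: "('k::{real_normed_field,banach}, 'v::ab_group_add, 'm) nalgebra_scheme" +
  assumes mul_closed: "\<lbrakk>x \<in> carrier B; y \<in> carrier B\<rbrakk> \<Longrightarrow> mul B x y \<in> carrier B"
    and mul_add_left: "\<lbrakk>x \<in> carrier B; y \<in> carrier B; z \<in> carrier B\<rbrakk> \<Longrightarrow>
          mul B (x + y) z = mul B x z + mul B y z"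
    and mul_add_right: "\<lbrakk>x \<in> carrier B; y \<in> carrier B; z \<in> carrier B\<rbrakk> \<Longrightarrow>
          mul B x (y + z) = mul B x y + mul B x z"
    and mul_smul_left: "\<lbrakk>x \<in> carrier B; y \<in> carrier B\<rbrakk> \<Longrightarrow> mul B (smul B c x) y = smul B c (mul B x y)"
    and mul_smul_right: "\<lbrakk>x \<in> carrier B; y \<in> carrier B\<rbrakk> \<Longrightarrow> mul B x (smul B c y) = smul B c (mul B x y)"
    and mul_assoc: "\<lbrakk>x \<in> carrier B; y \<in> carrier B; z \<in> carrier B\<rbrakk> \<Longrightarrow>
          mul B (mul B x y) z = mul B x (mul B y z)"
    and nrm_mul: "\<lbrakk>x \<in> carrier B; y \<in> carrier B\<rbrakk> \<Longrightarrow> nrm B (mul B x y) \<le> nrm B x * nrm B y"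

locale banach_bimodule = banach_algebra B + X: banach_space X
  for B :: "('k::{real_normed_field,banach}, 'b::ab_group_add, 'm) nalgebra_scheme"
    and X :: "('k, 'b, 'v::ab_group_add, 'l) nbimodule_scheme" +
  assumes lact_closed: "\<lbrakk>a \<in> carrier B; x \<in> carrier X\<rbrakk> \<Longrightarrow> lact X a x \<in> carrier X"
    and ract_closed: "\<lbrakk>a \<in> carrier B; x \<in> carrier X\<rbrakk> \<Longrightarrow> ract X x a \<in> carrier X"
    and lact_add_left: "\<lbrakk>a \<in> carrier B; b \<in> carrier B; x \<in> carrier X\<rbrakk> \<Longrightarrow>
          lact X (a + b) x = lact X a x + lact X b x"
    and lact_add_right: "\<lbrakk>a \<in> carrier B; x \<in> carrier X; y \<in> carrier X\<rbrakk> \<Longrightarrow>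
          lact X a (x + y) = lact X a x + lact X a y"
    and ract_add_left: "\<lbrakk>a \<in> carrier B; x \<in> carrier X; y \<in> carrier X\<rbrakk> \<Longrightarrow>
          ract X (x + y) a = ract X x a + ract X y a"
    and ract_add_right: "\<lbrakk>a \<in> carrier B; b \<in> carrier B; x \<in> carrier X\<rbrakk> \<Longrightarrow>
          ract X x (a + b) = ract X x a + ract X x b"
    and lact_smul: "\<lbrakk>a \<in> carrier B; x \<in> carrier X\<rbrakk> \<Longrightarrow>
          lact X (smul B c a) x = smul X c (lact X a x) \<and> lact X a (smul X c x) = smul X c (lact X a x)"
    and ract_smul: "\<lbrakk>a \<in> carrier B; x \<in> carrier X\<rbrakk> \<Longrightarrow>
          ract X x (smul B c a) = smul X c (ract X x a) \<and> ract X (smul X c x) a = smul X c (ract X x a)"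
    and lact_mul: "\<lbrakk>a \<in> carrier B; b \<in> carrier B; x \<in> carrier X\<rbrakk> \<Longrightarrow>
          lact X (mul B a b) x = lact X a (lact X b x)"
    and ract_mul: "\<lbrakk>a \<in> carrier B; b \<in> carrier B; x \<in> carrier X\<rbrakk> \<Longrightarrow>
          ract X x (mul B a b) = ract X (ract X x a) b"
    and lact_ract: "\<lbrakk>a \<in> carrier B; b \<in> carrier B; x \<in> carrier X\<rbrakk> \<Longrightarrow>
          ract X (lact X a x) b = lact X a (ract X x b)"
    and lact_bounded: "\<exists>K. \<forall>a\<in>carrier B. \<forall>x\<in>carrier X. nrm X (lact X a x) \<le> K * nrm B a * nrm X x"
    and ract_bounded: "\<exists>K. \<forall>a\<in>carrier B. \<forall>x\<in>carrier X. nrm X (ract X x a) \<le> K * nrm B a * nrm X x"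

definition bounded_linear_map ::
    "('k, 'v::ab_group_add, 'm) nspace_scheme \<Rightarrow> ('k, 'w::ab_group_add, 'l) nspace_scheme \<Rightarrow> ('v \<Rightarrow> 'w) \<Rightarrow> bool"
  where "bounded_linear_map X Y f \<longleftrightarrow>
    (\<forall>x\<in>carrier X. f x \<in> carrier Y) \<and>
    (\<forall>x\<in>carrier X. \<forall>y\<in>carrier X. f (x + y) = f x + f y) \<and>
    (\<forall>c. \<forall>x\<in>carrier X. f (smul X c x) = smul Y c (f x)) \<and>
    (\<exists>K. \<forall>x\<in>carrier X. nrm Y (f x) \<le> K * nrm X x)"

subsection \<open>Duals and adjoints\<close>

definition scalars :: "('k::real_normed_field, 'k) nspace"
  where "scalars = \<lparr>carrier = UNIV, smul = (*), nrm = norm\<rparr>"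

definition dual ::
    "('k::{real_normed_field,banach}, 'v::ab_group_add, 'm) nspace_scheme \<Rightarrow> ('k, 'v \<Rightarrow> 'k) nspace"
  where "dual X =
    \<lparr>carrier = {f. bounded_linear_map X scalars f \<and> (\<forall>x. x \<notin> carrier X \<longrightarrow> f x = 0)},
     smul = (\<lambda>c f x. c * f x),
     nrm = (\<lambda>f. SUP x\<in>{x \<in> carrier X. nrm X x \<le> 1}. norm (f x))\<rparr>"

text \<open>For \<open>T : X \<rightarrow> Y\<close>, \<open>adjoint X Y T : Y\<^sup>* \<rightarrow> X\<^sup>*\<close> and \<open>adjoint2 X Y T : X\<^sup>*\<^sup>* \<rightarrow> Y\<^sup>*\<^sup>*\<close>; both
  are \<open>0\<close> outside their domain.\<close>

definition adjoint ::
    "('k::{real_normed_field,banach}, 'v::ab_group_add, 'm) nspace_scheme \<Rightarrow>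
     ('k, 'w::ab_group_add, 'l) nspace_scheme \<Rightarrow> ('v \<Rightarrow> 'w) \<Rightarrow> ('w \<Rightarrow> 'k) \<Rightarrow> ('v \<Rightarrow> 'k)"
  where "adjoint X Y T g = (\<lambda>x. if g \<in> carrier (dual Y) \<and> x \<in> carrier X then g (T x) else 0)"

definition adjoint2 ::
    "('k::{real_normed_field,banach}, 'v::ab_group_add, 'm) nspace_scheme \<Rightarrow>
     ('k, 'w::ab_group_add, 'l) nspace_scheme \<Rightarrow> ('v \<Rightarrow> 'w) \<Rightarrow>
     (('v \<Rightarrow> 'k) \<Rightarrow> 'k) \<Rightarrow> (('w \<Rightarrow> 'k) \<Rightarrow> 'k)"
  where "adjoint2 X Y T = adjoint (dual Y) (dual X) (adjoint X Y T)"

subsection \<open>The dual bimodule and the first Arens product\<close>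

definition dual_bimodule ::
    "('k::{real_normed_field,banach}, 'v::ab_group_add, 'm) nalgebra_scheme \<Rightarrow> ('k, 'v, 'v \<Rightarrow> 'k) nbimodule"
  where "dual_bimodule B =
    \<lparr>carrier = carrier (dual B), smul = smul (dual B), nrm = nrm (dual B),
     lact = (\<lambda>a f b. if b \<in> carrier B then f (mul B b a) else 0),
     ract = (\<lambda>f a b. if b \<in> carrier B then f (mul B a b) else 0)\<rparr>"

definition arens_act ::
    "('k::{real_normed_field,banach}, 'v::ab_group_add, 'm) nalgebra_scheme \<Rightarrow>
     (('v \<Rightarrow> 'k) \<Rightarrow> 'k) \<Rightarrow> ('v \<Rightarrow> 'k) \<Rightarrow> ('v \<Rightarrow> 'k)"
  where "arens_act B G f = (\<lambda>a. if a \<in> carrier B then G (ract (dual_bimodule B) f a) else 0)"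

definition bidual ::
    "('k::{real_normed_field,banach}, 'v::ab_group_add, 'm) nalgebra_scheme \<Rightarrow>
     ('k, ('v \<Rightarrow> 'k) \<Rightarrow> 'k) nalgebra"
  where "bidual B =
    \<lparr>carrier = carrier (dual (dual B)), smul = smul (dual (dual B)), nrm = nrm (dual (dual B)),
     mul = (\<lambda>F G f. if f \<in> carrier (dual B) then F (arens_act B G f) else 0)\<rparr>"

subsection \<open>Iterated duals\<close>

definition isometric_isomorphism ::
    "('k::{real_normed_field,banach}, 'v::ab_group_add, 'm) nalgebra_scheme \<Rightarrow>
     ('k, 'w::ab_group_add, 'l) nalgebra_scheme \<Rightarrow> ('v \<Rightarrow> 'w) \<Rightarrow> bool"
  where "isometric_isomorphism B C \<phi> \<longleftrightarrow>
    bij_betw \<phi> (carrier B) (carrier C) \<and>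
    (\<forall>x\<in>carrier B. \<forall>y\<in>carrier B. \<phi> (x + y) = \<phi> x + \<phi> y) \<and>
    (\<forall>c. \<forall>x\<in>carrier B. \<phi> (smul B c x) = smul C c (\<phi> x)) \<and>
    (\<forall>x\<in>carrier B. \<forall>y\<in>carrier B. \<phi> (mul B x y) = mul C (\<phi> x) (\<phi> y)) \<and>
    (\<forall>x\<in>carrier B. nrm C (\<phi> x) = nrm B x)"

text \<open>
  \<open>even_dual A n B\<close> says that \<open>B\<close> is a copy of the Banach algebra \<open>A\<^sup>(\<^sup>n\<^sup>)\<close> (\<open>n\<close> even).  The types of
  the literal iterated duals \<open>A\<close>, \<open>(A \<Rightarrow> 'k) \<Rightarrow> 'k\<close>, ... change with \<open>n\<close>, so each of them is
  replaced by an isometrically isomorphic copy on one ambient type \<open>'w\<close>.  For every \<open>A\<close> and \<open>n\<close>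
  such copies exist when \<open>'w\<close> is large enough, e.g. the product of the literal types up to \<open>n\<close>.
\<close>

inductive even_dual ::
    "('k::{real_normed_field,banach}, 'v::ab_group_add) nalgebra \<Rightarrow> nat \<Rightarrow>
     ('k, 'w::ab_group_add) nalgebra \<Rightarrow> bool"
  for A where
  base: "isometric_isomorphism A B \<phi> \<Longrightarrow> even_dual A 0 B"
| step: "even_dual A n B \<Longrightarrow> isometric_isomorphism (bidual B) C \<phi> \<Longrightarrow> even_dual A (n + 2) C"

subsection \<open>Weak amenability\<close>

definition derivation ::
    "('k::{real_normed_field,banach}, 'b::ab_group_add, 'm) nalgebra_scheme \<Rightarrow>
     ('k, 'b, 'v::ab_group_add, 'l) nbimodule_scheme \<Rightarrow> ('b \<Rightarrow> 'b) \<Rightarrow> ('b \<Rightarrow> 'b) \<Rightarrow> ('b \<Rightarrow> 'v) \<Rightarrow> bool"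
  where "derivation B X T S D \<longleftrightarrow>
    bounded_linear_map B X D \<and>
    (\<forall>x\<in>carrier B. \<forall>y\<in>carrier B. D (mul B x y) = lact X (T x) (D y) + ract X (D x) (S y))"

definition inner_derivation ::
    "('k::{real_normed_field,banach}, 'b::ab_group_add, 'm) nalgebra_scheme \<Rightarrow>
     ('k, 'b, 'v::ab_group_add, 'l) nbimodule_scheme \<Rightarrow> ('b \<Rightarrow> 'b) \<Rightarrow> ('b \<Rightarrow> 'b) \<Rightarrow> ('b \<Rightarrow> 'v) \<Rightarrow> bool"
  where "inner_derivation B X T S D \<longleftrightarrow>
    derivation B X T S D \<and>
    (\<exists>x\<in>carrier X. \<forall>a\<in>carrier B. D a = lact X (T a) x - ract X x (S a))"

definition weakly_amenable ::
    "('k::{real_normed_field,banach}, 'b::ab_group_add, 'm) nalgebra_scheme \<Rightarrow> ('b \<Rightarrow> 'b) \<Rightarrow> ('b \<Rightarrow> 'b) \<Rightarrow> bool"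
  where "weakly_amenable B T S \<longleftrightarrow>
    (\<forall>D. derivation B (dual_bimodule B) T S D \<longrightarrow> inner_derivation B (dual_bimodule B) T S D)"

subsection \<open>Weak topologies\<close>

definition initial_topology :: "'v set \<Rightarrow> ('v \<Rightarrow> 'k::topological_space) set \<Rightarrow> 'v topology"
  where "initial_topology V \<Phi> = topology_generated_by {{v \<in> V. \<phi> v \<in> U} |\<phi> U. \<phi> \<in> \<Phi> \<and> open U}"

definition weak_topology ::
    "('k::{real_normed_field,banach}, 'v::ab_group_add, 'm) nspace_scheme \<Rightarrow> 'v topology"
  where "weak_topology X = initial_topology (carrier X) (carrier (dual X))"

definition weak_star_topology ::
    "('k::{real_normed_field,banach}, 'v::ab_group_add, 'm) nspace_scheme \<Rightarrow> ('v \<Rightarrow> 'k) topology"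
  where "weak_star_topology X = initial_topology (carrier (dual X)) ((\<lambda>x f. f x) ` carrier X)"

definition wstar_w_property ::
    "('k::{real_normed_field,banach}, 'v::ab_group_add, 'm) nalgebra_scheme \<Rightarrow> ('v \<Rightarrow> 'v) \<Rightarrow> bool"
  where "wstar_w_property B T \<longleftrightarrow>
    (\<forall>F\<in>carrier (bidual B).
       continuous_map (weak_star_topology (dual B)) (weak_topology (bidual B))
         (\<lambda>G. mul (bidual B) F (adjoint2 B B T G)))"

subsection \<open>The constructions yield Banach spaces, bimodules and algebras\<close>

context banach_space begin

lemma smul_zero_left: "x \<in> carrier X \<Longrightarrow> smul X 0 x = 0"
  using smul_add_left[of x 0 0] by simp

lemma smul_minus_one: "x \<in> carrier X \<Longrightarrow> smul X (-1) x = - x"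
  using smul_add_left[of x 1 "-1"] smul_one smul_zero_left
  by (simp add: add_eq_0_iff2 minus_unique)

lemma uminus_closed: "x \<in> carrier X \<Longrightarrow> - x \<in> carrier X"
  using smul_closed smul_minus_one by metis

lemma diff_closed: "\<lbrakk>x \<in> carrier X; y \<in> carrier X\<rbrakk> \<Longrightarrow> x - y \<in> carrier X"
  using add_closed uminus_closed by (metis diff_conv_add_uminus)

lemma nrm_zero: "nrm X 0 = 0"
  using nrm_eq_zero_iff zero_closed by blast

lemma nrm_uminus: "x \<in> carrier X \<Longrightarrow> nrm X (- x) = nrm X x"
  using nrm_smul[of x "-1"] smul_minus_one by simp

lemma nrm_nonneg: "x \<in> carrier X \<Longrightarrow> 0 \<le> nrm X x"
  using nrm_triangle[of x "- x"] uminus_closed nrm_uminus nrm_zero by fastforce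

lemma dual_iff: "f \<in> carrier (dual X) \<longleftrightarrow>
   (\<forall>x\<in>carrier X. \<forall>y\<in>carrier X. f (x + y) = f x + f y) \<and>
   (\<forall>c. \<forall>x\<in>carrier X. f (smul X c x) = c * f x) \<and>
   (\<exists>K. \<forall>x\<in>carrier X. norm (f x) \<le> K * nrm X x) \<and> (\<forall>x. x \<notin> carrier X \<longrightarrow> f x = 0)"
  by (simp add: dual_def bounded_linear_map_def scalars_def)

lemma dual_add: "\<lbrakk>f \<in> carrier (dual X); x \<in> carrier X; y \<in> carrier X\<rbrakk> \<Longrightarrow> f (x + y) = f x + f y"
  and dual_smul: "\<lbrakk>f \<in> carrier (dual X); x \<in> carrier X\<rbrakk> \<Longrightarrow> f (smul X c x) = c * f x"
  and dual_outside: "\<lbrakk>f \<in> carrier (dual X); x \<notin> carrier X\<rbrakk> \<Longrightarrow> f x = 0"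
  by (auto simp: dual_iff)

lemma dual_diff: "\<lbrakk>f \<in> carrier (dual X); x \<in> carrier X; y \<in> carrier X\<rbrakk> \<Longrightarrow> f (x - y) = f x - f y"
  using dual_add[of f "x - y" y] diff_closed by (simp add: algebra_simps)

lemma smul_dual: "smul (dual X) c f = (\<lambda>x. c * f x)"
  by (simp add: dual_def)

lemma nrm_dual: "nrm (dual X) f = (SUP x\<in>{x \<in> carrier X. nrm X x \<le> 1}. norm (f x))"
  by (simp add: dual_def)

lemma dual_bdd: assumes "f \<in> carrier (dual X)"
  shows "bdd_above ((\<lambda>x. norm (f x)) ` {x \<in> carrier X. nrm X x \<le> 1})"
proof -
  obtain K where K: "\<And>x. x \<in> carrier X \<Longrightarrow> norm (f x) \<le> K * nrm X x"
    using assms dual_iff[of f] by blast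
  have "norm (f x) \<le> \<bar>K\<bar>" if "x \<in> carrier X" "nrm X x \<le> 1" for x
  proof -
    have "K * nrm X x \<le> \<bar>K\<bar> * nrm X x" using nrm_nonneg[OF that(1)] by (intro mult_right_mono) auto
    also have "\<dots> \<le> \<bar>K\<bar>" using that(2) by (simp add: mult_left_le)
    finally show ?thesis using K[OF that(1)] by simp
  qed
  then show ?thesis by (intro bdd_aboveI2) auto
qed

lemma nrm_dual_nonneg: assumes "f \<in> carrier (dual X)" shows "0 \<le> nrm (dual X) f"
proof -
  have "norm (f 0) \<le> nrm (dual X) f"
    unfolding nrm_dual by (rule cSUP_upper[OF _ dual_bdd[OF assms]]) (simp add: zero_closed nrm_zero)
  then show ?thesis using norm_ge_zero order_trans by blast
qed

lemma norm_dual_le: assumes f: "f \<in> carrier (dual X)" and x: "x \<in> carrier X"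
  shows "norm (f x) \<le> nrm (dual X) f * nrm X x"
proof (cases "x = 0")
  case True
  have "f 0 = 0" using dual_add[OF f zero_closed zero_closed] by simp
  then show ?thesis using True nrm_zero by simp
next
  case False
  define r where "r = nrm X x"
  have r: "r > 0" using False nrm_nonneg[OF x] nrm_eq_zero_iff[OF x] by (simp add: r_def)
  let ?y = "smul X (of_real (1/r)) x"
  have "norm (f ?y) \<le> nrm (dual X) f"
    unfolding nrm_dual
    by (rule cSUP_upper[OF _ dual_bdd[OF f]])
       (use r x smul_closed nrm_smul[OF x] in \<open>auto simp: r_def norm_divide simp del: of_real_divide\<close>)
  moreover have "norm (f ?y) = norm (f x) / r"
    using dual_smul[OF f x] r by (simp add: norm_mult norm_divide)
  ultimately show ?thesis using r by (simp add: r_def field_simps)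
qed

lemma nrm_dual_le:
  assumes "f \<in> carrier (dual X)" and "0 \<le> K" "\<And>x. x \<in> carrier X \<Longrightarrow> norm (f x) \<le> K * nrm X x"
  shows "nrm (dual X) f \<le> K"
  unfolding nrm_dual
proof (rule cSUP_least)
  show "{x \<in> carrier X. nrm X x \<le> 1} \<noteq> {}" using zero_closed nrm_zero by auto
  fix x assume x: "x \<in> {x \<in> carrier X. nrm X x \<le> 1}"
  then have "norm (f x) \<le> K * nrm X x" using assms by auto
  also have "\<dots> \<le> K" using x assms(2) by (simp add: mult_left_le)
  finally show "norm (f x) \<le> K" .
qed

lemma dualI:
  assumes "\<And>x y. \<lbrakk>x \<in> carrier X; y \<in> carrier X\<rbrakk> \<Longrightarrow> f (x + y) = f x + f y"
    and "\<And>c x. x \<in> carrier X \<Longrightarrow> f (smul X c x) = c * f x"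
    and "\<And>x. x \<in> carrier X \<Longrightarrow> norm (f x) \<le> K * nrm X x"
    and "\<And>x. x \<notin> carrier X \<Longrightarrow> f x = 0"
  shows "f \<in> carrier (dual X)"
  unfolding dual_iff using assms by blast

lemma dual_add_closed: assumes "f \<in> carrier (dual X)" "g \<in> carrier (dual X)"
  shows "f + g \<in> carrier (dual X)"
proof (rule dualI)
  fix x assume x: "x \<in> carrier X"
  have "norm ((f + g) x) \<le> norm (f x) + norm (g x)" by (simp add: norm_triangle_ineq)
  also have "\<dots> \<le> (nrm (dual X) f + nrm (dual X) g) * nrm X x"
    using norm_dual_le[OF assms(1) x] norm_dual_le[OF assms(2) x] by (simp add: algebra_simps)
  finally show "norm ((f + g) x) \<le> (nrm (dual X) f + nrm (dual X) g) * nrm X x" .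
qed (use assms in \<open>auto simp: dual_add dual_smul dual_outside algebra_simps\<close>)

lemma dual_smul_closed: assumes "f \<in> carrier (dual X)"
  shows "smul (dual X) c f \<in> carrier (dual X)"
  unfolding smul_dual
proof (rule dualI)
  fix x assume x: "x \<in> carrier X"
  show "norm (c * f x) \<le> (norm c * nrm (dual X) f) * nrm X x"
    using norm_dual_le[OF assms(1) x] by (simp add: norm_mult mult_left_mono mult.assoc)
qed (use assms in \<open>auto simp: dual_add dual_smul dual_outside algebra_simps\<close>)

lemma dual_eqI: assumes "f \<in> carrier (dual X)" "g \<in> carrier (dual X)"
    "\<And>x. x \<in> carrier X \<Longrightarrow> f x = g x" shows "f = g"
  using assms dual_outside by (metis ext)

lemma nrm_smul_dual: assumes f: "f \<in> carrier (dual X)"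
  shows "nrm (dual X) (smul (dual X) c f) = norm c * nrm (dual X) f"
proof -
  have le: "nrm (dual X) (smul (dual X) c g) \<le> norm c * nrm (dual X) g"
    if g: "g \<in> carrier (dual X)" for c g
    by (rule nrm_dual_le[OF dual_smul_closed[OF g]])
       (use norm_dual_le[OF g] nrm_dual_nonneg[OF g] in \<open>auto simp: smul_dual norm_mult mult_left_mono mult.assoc\<close>)
  show ?thesis
  proof (cases "c = 0")
    case True then show ?thesis
      using le[OF f, of c] nrm_dual_nonneg[OF dual_smul_closed[OF f], of c] by simp
  next
    case False
    have "smul (dual X) (inverse c) (smul (dual X) c f) = f" using False by (simp add: smul_dual fun_eq_iff)
    then have "nrm (dual X) f \<le> norm (inverse c) * nrm (dual X) (smul (dual X) c f)"
      using le[OF dual_smul_closed[OF f], of "inverse c" c] by simp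
    then have "norm c * nrm (dual X) f \<le> nrm (dual X) (smul (dual X) c f)"
      using False by (simp add: norm_divide field_simps)
    then show ?thesis using le[OF f, of c] by simp
  qed
qed

lemma dual_zero_closed: "0 \<in> carrier (dual X)"
  by (rule dualI[where K=0]) auto

lemma dual_diff_closed: assumes "f \<in> carrier (dual X)" "g \<in> carrier (dual X)"
  shows "f - g \<in> carrier (dual X)"
proof -
  have "f - g = f + smul (dual X) (-1) g" by (simp add: smul_dual fun_eq_iff)
  then show ?thesis using dual_add_closed[OF assms(1) dual_smul_closed[OF assms(2), of "-1"]] by (simp only:)
qed

lemma banach_space_dual: "banach_space (dual X)"
proof
  fix f g :: "'v \<Rightarrow> 'k" assume f: "f \<in> carrier (dual X)" and g: "g \<in> carrier (dual X)"
  show "nrm (dual X) (f + g) \<le> nrm (dual X) f + nrm (dual X) g"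
  proof (rule nrm_dual_le[OF dual_add_closed[OF f g]])
    fix x assume x: "x \<in> carrier X"
    have "norm ((f + g) x) \<le> norm (f x) + norm (g x)" by (simp add: norm_triangle_ineq)
    also have "\<dots> \<le> (nrm (dual X) f + nrm (dual X) g) * nrm X x"
      using norm_dual_le[OF f x] norm_dual_le[OF g x] by (simp add: algebra_simps)
    finally show "norm ((f + g) x) \<le> (nrm (dual X) f + nrm (dual X) g) * nrm X x" .
  qed (use nrm_dual_nonneg f g in simp)
next
  fix f :: "'v \<Rightarrow> 'k" assume f: "f \<in> carrier (dual X)"
  show "nrm (dual X) f = 0 \<longleftrightarrow> f = 0"
  proof
    assume n: "nrm (dual X) f = 0"
    show "f = 0"
    proof (rule dual_eqI[OF f dual_zero_closed])
      fix x assume "x \<in> carrier X"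
      then show "f x = 0 x" using norm_dual_le[OF f, of x] n by simp
    qed
  next
    assume "f = 0"
    then have "nrm (dual X) f \<le> 0" by (intro nrm_dual_le[OF f]) auto
    then show "nrm (dual X) f = 0" using nrm_dual_nonneg[OF f] by simp
  qed
next
  fix \<sigma> :: "nat \<Rightarrow> 'v \<Rightarrow> 'k"
  assume s: "\<And>i. \<sigma> i \<in> carrier (dual X)"
    and C: "\<And>e. e > 0 \<Longrightarrow> \<exists>N. \<forall>i\<ge>N. \<forall>j\<ge>N. nrm (dual X) (\<sigma> i - \<sigma> j) < e"
  have le: "norm (\<sigma> i x - \<sigma> j x) \<le> nrm (dual X) (\<sigma> i - \<sigma> j) * nrm X x" if "x \<in> carrier X" for i j x
    using norm_dual_le[OF dual_diff_closed[OF s s] that] by simp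
  have conv: "convergent (\<lambda>i. \<sigma> i x)" for x
  proof (cases "x \<in> carrier X")
    case x: True
    have "Cauchy (\<lambda>i. \<sigma> i x)"
    proof (rule CauchyI)
      fix e :: real assume e: "e > 0"
      have p: "nrm X x + 1 > 0" using nrm_nonneg[OF x] by simp
      obtain N where N: "\<forall>i\<ge>N. \<forall>j\<ge>N. nrm (dual X) (\<sigma> i - \<sigma> j) < e / (nrm X x + 1)"
        using C[of "e / (nrm X x + 1)"] e p by auto
      have "norm (\<sigma> i x - \<sigma> j x) < e" if "i \<ge> N" "j \<ge> N" for i j
      proof -
        have "norm (\<sigma> i x - \<sigma> j x) \<le> nrm (dual X) (\<sigma> i - \<sigma> j) * (nrm X x + 1)"
          using le[OF x, of i j] nrm_dual_nonneg[OF dual_diff_closed[OF s s], of i j]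
          by (simp add: algebra_simps)
        also have "\<dots> < e" using N that p by (simp add: field_simps)
        finally show ?thesis .
      qed
      then show "\<exists>N. \<forall>i\<ge>N. \<forall>j\<ge>N. norm (\<sigma> i x - \<sigma> j x) < e" by blast
    qed
    then show ?thesis by (rule Cauchy_convergent)
  next
    case False
    then have "(\<lambda>i. \<sigma> i x) = (\<lambda>i. 0)" using s dual_outside by auto
    then show ?thesis by (simp add: convergent_const)
  qed
  define f where "f = (\<lambda>x. lim (\<lambda>i. \<sigma> i x))"
  have lim: "(\<lambda>i. \<sigma> i x) \<longlonglongrightarrow> f x" for x
    using conv convergent_LIMSEQ_iff f_def by blast
  have tail: "norm (\<sigma> i x - f x) \<le> e * nrm X x"
    if N: "\<forall>i\<ge>N. \<forall>j\<ge>N. nrm (dual X) (\<sigma> i - \<sigma> j) < e" and i: "i \<ge> N" and x: "x \<in> carrier X" for e i x N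
  proof -
    have "(\<lambda>j. norm (\<sigma> i x - \<sigma> j x)) \<longlonglongrightarrow> norm (\<sigma> i x - f x)"
      by (intro tendsto_intros lim)
    moreover have "\<forall>j\<ge>N. norm (\<sigma> i x - \<sigma> j x) \<le> e * nrm X x"
    proof (intro allI impI)
      fix j assume "j \<ge> N"
      then have "nrm (dual X) (\<sigma> i - \<sigma> j) * nrm X x \<le> e * nrm X x"
        using N i by (intro mult_right_mono nrm_nonneg[OF x] less_imp_le) blast
      then show "norm (\<sigma> i x - \<sigma> j x) \<le> e * nrm X x" using le[OF x, of i j] by linarith
    qed
    ultimately show ?thesis by (meson Lim_bounded)
  qed
  have f: "f \<in> carrier (dual X)"
  proof -
    obtain N where N: "\<forall>i\<ge>N. \<forall>j\<ge>N. nrm (dual X) (\<sigma> i - \<sigma> j) < 1" using C[of 1] by auto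
    show ?thesis
    proof (rule dualI)
      fix x y assume xy: "x \<in> carrier X" "y \<in> carrier X"
      have "(\<lambda>i. \<sigma> i (x + y)) = (\<lambda>i. \<sigma> i x + \<sigma> i y)" using dual_add[OF s xy] by auto
      then have "(\<lambda>i. \<sigma> i (x + y)) \<longlonglongrightarrow> f x + f y" using tendsto_add[OF lim lim] by simp
      then show "f (x + y) = f x + f y" using lim LIMSEQ_unique by blast
    next
      fix c x assume x: "x \<in> carrier X"
      have "(\<lambda>i. \<sigma> i (smul X c x)) = (\<lambda>i. c * \<sigma> i x)" using dual_smul[OF s x] by auto
      then have "(\<lambda>i. \<sigma> i (smul X c x)) \<longlonglongrightarrow> c * f x" using tendsto_mult_left[OF lim] by simp
      then show "f (smul X c x) = c * f x" using lim LIMSEQ_unique by blast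
    next
      fix x assume "x \<notin> carrier X"
      then show "f x = 0" using dual_outside[OF s] by (simp add: f_def)
    next
      fix x assume x: "x \<in> carrier X"
      have "norm (f x) \<le> norm (\<sigma> N x) + norm (\<sigma> N x - f x)"
        using norm_triangle_ineq4[of "\<sigma> N x" "\<sigma> N x - f x"] by simp
      also have "\<dots> \<le> (nrm (dual X) (\<sigma> N) + 1) * nrm X x"
        using norm_dual_le[OF s x, of N] tail[OF N _ x, of N] by (simp add: algebra_simps)
      finally show "norm (f x) \<le> (nrm (dual X) (\<sigma> N) + 1) * nrm X x" .
    qed
  qed
  have "(\<lambda>i. nrm (dual X) (\<sigma> i - f)) \<longlonglongrightarrow> 0"
  proof (rule LIMSEQ_I)
    fix e :: real assume "e > 0"
    then obtain N where N: "\<forall>i\<ge>N. \<forall>j\<ge>N. nrm (dual X) (\<sigma> i - \<sigma> j) < e / 2" using C[of "e/2"] by auto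
    have *: "nrm (dual X) (\<sigma> i - f) \<le> e / 2" if "i \<ge> N" for i
      by (rule nrm_dual_le[OF dual_diff_closed[OF s f]]) (use tail[OF N that] \<open>e > 0\<close> in auto)
    then show "\<exists>N. \<forall>i\<ge>N. norm (nrm (dual X) (\<sigma> i - f) - 0) < e"
    proof (intro exI[of _ N] allI impI)
      fix i assume "i \<ge> N"
      then have "nrm (dual X) (\<sigma> i - f) \<le> e / 2" by (rule *)
      then show "norm (nrm (dual X) (\<sigma> i - f) - 0) < e"
        using \<open>e > 0\<close> nrm_dual_nonneg[OF dual_diff_closed[OF s f], of i] by simp
    qed
  qed
  then show "\<exists>f\<in>carrier (dual X). (\<lambda>i. nrm (dual X) (\<sigma> i - f)) \<longlonglongrightarrow> 0" using f by blast
qed (simp_all add: dual_zero_closed dual_add_closed dual_smul_closed nrm_smul_dual, simp_all add: smul_dual fun_eq_iff algebra_simps)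

end


lemma (in banach_algebra) dual_bimodule_simps:
  "carrier (dual_bimodule B) = carrier (dual B)"
  "smul (dual_bimodule B) = smul (dual B)"
  "nrm (dual_bimodule B) = nrm (dual B)"
  "lact (dual_bimodule B) a f = (\<lambda>b. if b \<in> carrier B then f (mul B b a) else 0)"
  "ract (dual_bimodule B) f a = (\<lambda>b. if b \<in> carrier B then f (mul B a b) else 0)"
  by (simp_all add: dual_bimodule_def)

lemma (in banach_algebra) lact_dual:
  assumes f: "f \<in> carrier (dual B)" and a: "a \<in> carrier B"
  shows "lact (dual_bimodule B) a f \<in> carrier (dual B)"
    and "nrm (dual B) (lact (dual_bimodule B) a f) \<le> nrm (dual B) f * nrm B a"
proof -
  have le: "norm (lact (dual_bimodule B) a f b) \<le> (nrm (dual B) f * nrm B a) * nrm B b"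
    if b: "b \<in> carrier B" for b
  proof -
    have "norm (f (mul B b a)) \<le> nrm (dual B) f * nrm B (mul B b a)"
      by (rule norm_dual_le[OF f mul_closed[OF b a]])
    also have "\<dots> \<le> nrm (dual B) f * (nrm B b * nrm B a)"
      by (rule mult_left_mono[OF nrm_mul[OF b a] nrm_dual_nonneg[OF f]])
    finally show ?thesis using b by (simp add: dual_bimodule_simps mult_ac)
  qed
  show 1: "lact (dual_bimodule B) a f \<in> carrier (dual B)"
    by (rule dualI[OF _ _ le])
       (use f a in \<open>auto simp: dual_bimodule_simps add_closed smul_closed mul_add_left mul_smul_left
          dual_add dual_smul mul_closed\<close>)
  show "nrm (dual B) (lact (dual_bimodule B) a f) \<le> nrm (dual B) f * nrm B a"
    by (rule nrm_dual_le[OF 1 _ le]) (use f a nrm_nonneg nrm_dual_nonneg in auto)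
qed

lemma (in banach_algebra) ract_dual:
  assumes f: "f \<in> carrier (dual B)" and a: "a \<in> carrier B"
  shows "ract (dual_bimodule B) f a \<in> carrier (dual B)"
    and "nrm (dual B) (ract (dual_bimodule B) f a) \<le> nrm (dual B) f * nrm B a"
proof -
  have le: "norm (ract (dual_bimodule B) f a b) \<le> (nrm (dual B) f * nrm B a) * nrm B b"
    if b: "b \<in> carrier B" for b
  proof -
    have "norm (f (mul B a b)) \<le> nrm (dual B) f * nrm B (mul B a b)"
      by (rule norm_dual_le[OF f mul_closed[OF a b]])
    also have "\<dots> \<le> nrm (dual B) f * (nrm B a * nrm B b)"
      by (rule mult_left_mono[OF nrm_mul[OF a b] nrm_dual_nonneg[OF f]])
    finally show ?thesis using b by (simp add: dual_bimodule_simps mult_ac)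
  qed
  show 1: "ract (dual_bimodule B) f a \<in> carrier (dual B)"
    by (rule dualI[OF _ _ le])
       (use f a in \<open>auto simp: dual_bimodule_simps add_closed smul_closed mul_add_right mul_smul_right
          dual_add dual_smul mul_closed\<close>)
  show "nrm (dual B) (ract (dual_bimodule B) f a) \<le> nrm (dual B) f * nrm B a"
    by (rule nrm_dual_le[OF 1 _ le]) (use f a nrm_nonneg nrm_dual_nonneg in auto)
qed

lemma banach_space_cong:
  assumes "banach_space X" "carrier Y = carrier X" "smul Y = smul X" "nrm Y = nrm X"
  shows "banach_space Y"
  using assms unfolding banach_space_def by simp

lemma (in banach_algebra) banach_bimodule_dual_bimodule: "banach_bimodule B (dual_bimodule B)"
proof -
  interpret X: banach_space "dual_bimodule B"
    by (rule banach_space_cong[OF banach_space_dual]) (auto simp: dual_bimodule_simps)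
  show ?thesis
  proof
    show "\<exists>K. \<forall>a\<in>carrier B. \<forall>x\<in>carrier (dual_bimodule B).
       nrm (dual_bimodule B) (lact (dual_bimodule B) a x) \<le> K * nrm B a * nrm (dual_bimodule B) x"
      using lact_dual(2) by (intro exI[of _ 1]) (auto simp: dual_bimodule_simps(1-3) mult_ac)
    show "\<exists>K. \<forall>a\<in>carrier B. \<forall>x\<in>carrier (dual_bimodule B).
       nrm (dual_bimodule B) (ract (dual_bimodule B) x a) \<le> K * nrm B a * nrm (dual_bimodule B) x"
      using ract_dual(2) by (intro exI[of _ 1]) (auto simp: dual_bimodule_simps(1-3) mult_ac)
  next
    fix a x assume ax: "a \<in> carrier B" "x \<in> carrier (dual_bimodule B)"
    then show "lact (dual_bimodule B) a x \<in> carrier (dual_bimodule B)"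
      "ract (dual_bimodule B) x a \<in> carrier (dual_bimodule B)"
      using lact_dual(1) ract_dual(1) by (auto simp: dual_bimodule_simps(1))
    show "lact (dual_bimodule B) (smul B c a) x = smul (dual_bimodule B) c (lact (dual_bimodule B) a x) \<and>
          lact (dual_bimodule B) a (smul (dual_bimodule B) c x) = smul (dual_bimodule B) c (lact (dual_bimodule B) a x)"
      "ract (dual_bimodule B) x (smul B c a) = smul (dual_bimodule B) c (ract (dual_bimodule B) x a) \<and>
          ract (dual_bimodule B) (smul (dual_bimodule B) c x) a = smul (dual_bimodule B) c (ract (dual_bimodule B) x a)" for c
      using ax dual_smul[of x] unfolding dual_bimodule_simps
      by (simp_all add: smul_dual fun_eq_iff mul_smul_left mul_smul_right mul_closed)
    fix b assume b: "b \<in> carrier B"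
    show "lact (dual_bimodule B) (mul B a b) x = lact (dual_bimodule B) a (lact (dual_bimodule B) b x)"
      "ract (dual_bimodule B) x (mul B a b) = ract (dual_bimodule B) (ract (dual_bimodule B) x a) b"
      "ract (dual_bimodule B) (lact (dual_bimodule B) a x) b = lact (dual_bimodule B) a (ract (dual_bimodule B) x b)"
      using ax b unfolding dual_bimodule_simps by (simp_all add: fun_eq_iff mul_closed mul_assoc)
    show "lact (dual_bimodule B) (a + b) x = lact (dual_bimodule B) a x + lact (dual_bimodule B) b x"
      "ract (dual_bimodule B) x (a + b) = ract (dual_bimodule B) x a + ract (dual_bimodule B) x b"
      using ax b dual_add[of x] unfolding dual_bimodule_simps
      by (simp_all add: fun_eq_iff mul_closed mul_add_left mul_add_right)
  next
    fix a x y assume "a \<in> carrier B" "x \<in> carrier (dual_bimodule B)" "y \<in> carrier (dual_bimodule B)"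
    show "lact (dual_bimodule B) a (x + y) = lact (dual_bimodule B) a x + lact (dual_bimodule B) a y"
      "ract (dual_bimodule B) (x + y) a = ract (dual_bimodule B) x a + ract (dual_bimodule B) y a"
      unfolding dual_bimodule_simps by (simp_all add: fun_eq_iff)
  qed
qed

lemma (in banach_algebra) arens_act_dual:
  assumes G: "G \<in> carrier (dual (dual B))" and f: "f \<in> carrier (dual B)"
  shows "arens_act B G f \<in> carrier (dual B)"
    and "nrm (dual B) (arens_act B G f) \<le> nrm (dual (dual B)) G * nrm (dual B) f"
proof -
  interpret X: banach_bimodule B "dual_bimodule B" by (rule banach_bimodule_dual_bimodule)
  interpret D: banach_space "dual B" by (rule banach_space_dual)
  note s = dual_bimodule_simps(1-3)
  have le: "norm (arens_act B G f b) \<le> (nrm (dual (dual B)) G * nrm (dual B) f) * nrm B b"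
    if b: "b \<in> carrier B" for b
  proof -
    have "norm (G (ract (dual_bimodule B) f b)) \<le> nrm (dual (dual B)) G * nrm (dual B) (ract (dual_bimodule B) f b)"
      by (rule D.norm_dual_le[OF G ract_dual(1)[OF f b]])
    also have "\<dots> \<le> nrm (dual (dual B)) G * (nrm (dual B) f * nrm B b)"
      by (rule mult_left_mono[OF ract_dual(2)[OF f b] D.nrm_dual_nonneg[OF G]])
    finally show ?thesis using b by (simp add: arens_act_def mult_ac)
  qed
  show 1: "arens_act B G f \<in> carrier (dual B)"
    by (rule dualI[OF _ _ le])
       (use f G X.ract_add_right X.ract_smul ract_dual(1) in \<open>auto simp: arens_act_def s add_closed smul_closed
          D.dual_add D.dual_smul\<close>)
  show "nrm (dual B) (arens_act B G f) \<le> nrm (dual (dual B)) G * nrm (dual B) f"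
    by (rule nrm_dual_le[OF 1 _ le]) (use f G D.nrm_dual_nonneg nrm_dual_nonneg in auto)
qed

theorem (in banach_algebra) banach_algebra_bidual: "banach_algebra (bidual B)"
proof -
  interpret X: banach_bimodule B "dual_bimodule B" by (rule banach_bimodule_dual_bimodule)
  interpret D: banach_space "dual B" by (rule banach_space_dual)
  interpret DD: banach_space "dual (dual B)" by (rule D.banach_space_dual)
  have bs: "carrier (bidual B) = carrier (dual (dual B))"
    "smul (bidual B) = smul (dual (dual B))" "nrm (bidual B) = nrm (dual (dual B))"
    "mul (bidual B) F G = (\<lambda>f. if f \<in> carrier (dual B) then F (arens_act B G f) else 0)" for F G
    by (simp_all add: bidual_def)
  have mul_eq: "mul (bidual B) F G f = (if f \<in> carrier (dual B) then F (arens_act B G f) else 0)" for F G f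
    by (simp add: bidual_def)
  note s = dual_bimodule_simps(1-3)
  interpret BB: banach_space "bidual B"
    by (rule banach_space_cong[OF D.banach_space_dual]) (auto simp: bs)
  have act_add: "arens_act B G (f + g) = arens_act B G f + arens_act B G g"
    if "G \<in> carrier (dual (dual B))" "f \<in> carrier (dual B)" "g \<in> carrier (dual B)" for f g G
    using that X.ract_add_left ract_dual(1) by (intro ext) (auto simp: arens_act_def s D.dual_add)
  have act_smul: "arens_act B G (smul (dual B) c f) = smul (dual B) c (arens_act B G f)"
    if "G \<in> carrier (dual (dual B))" "f \<in> carrier (dual B)" for f c G
  proof
    fix a
    have "G (ract (dual_bimodule B) (smul (dual B) c f) a) = c * G (ract (dual_bimodule B) f a)" if a: "a \<in> carrier B"
    proof -
      have "ract (dual_bimodule B) (smul (dual B) c f) a = smul (dual B) c (ract (dual_bimodule B) f a)"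
        using X.ract_smul[of a f c] a \<open>f \<in> carrier (dual B)\<close> by (simp add: s)
      then show ?thesis using D.dual_smul[OF \<open>G \<in> _\<close> ract_dual(1)[OF \<open>f \<in> _\<close> a]] by simp
    qed
    then show "arens_act B G (smul (dual B) c f) a = smul (dual B) c (arens_act B G f) a"
      by (simp add: arens_act_def smul_dual[of c "\<lambda>a. if a \<in> carrier B then G (ract (dual_bimodule B) f a) else 0"])
  qed
  have le: "norm (mul (bidual B) F G f) \<le> (nrm (dual (dual B)) F * nrm (dual (dual B)) G) * nrm (dual B) f"
    if F: "F \<in> carrier (dual (dual B))" and G: "G \<in> carrier (dual (dual B))" and f: "f \<in> carrier (dual B)"
    for F G f
  proof -
    have "norm (F (arens_act B G f)) \<le> nrm (dual (dual B)) F * nrm (dual B) (arens_act B G f)"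
      by (rule D.norm_dual_le[OF F arens_act_dual(1)[OF G f]])
    also have "\<dots> \<le> nrm (dual (dual B)) F * (nrm (dual (dual B)) G * nrm (dual B) f)"
      by (rule mult_left_mono[OF arens_act_dual(2)[OF G f] D.nrm_dual_nonneg[OF F]])
    finally show ?thesis using f by (simp add: bs mult_ac)
  qed
  have closed: "mul (bidual B) F G \<in> carrier (dual (dual B))"
    if F: "F \<in> carrier (dual (dual B))" and G: "G \<in> carrier (dual (dual B))" for F G
    by (rule D.dualI[OF _ _ le[OF F G]])
       (use F G arens_act_dual(1) in \<open>auto simp: bs D.add_closed D.smul_closed act_add act_smul D.dual_add D.dual_smul\<close>)
  have act_mul: "arens_act B (mul (bidual B) F G) f = arens_act B F (arens_act B G f)"
    if F: "F \<in> carrier (dual (dual B))" and G: "G \<in> carrier (dual (dual B))" and f: "f \<in> carrier (dual B)"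
    for F G f
  proof -
    have "arens_act B G (ract (dual_bimodule B) f a) = ract (dual_bimodule B) (arens_act B G f) a"
      if a: "a \<in> carrier B" for a
      using a f X.ract_mul by (simp add: arens_act_def fun_eq_iff s) (simp add: dual_bimodule_simps mul_closed)
    then have "arens_act B (mul (bidual B) F G) f a = arens_act B F (arens_act B G f) a" for a
      using ract_dual(1)[OF f, of a]
      by (cases "a \<in> carrier B") (simp_all only: arens_act_def[of B "mul (bidual B) F G"] arens_act_def[of B F] mul_eq if_True if_False)
    then show ?thesis by blast
  qed
  have act_add_left: "arens_act B (F + G) f = arens_act B F f + arens_act B G f"
    and act_smul_left: "arens_act B (smul (dual (dual B)) c F) f = smul (dual B) c (arens_act B F f)" for F G f c
    by (auto simp: arens_act_def fun_eq_iff smul_dual D.smul_dual)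
  show ?thesis
  proof
    fix F G assume FG: "F \<in> carrier (bidual B)" "G \<in> carrier (bidual B)"
    then show "nrm (bidual B) (mul (bidual B) F G) \<le> nrm (bidual B) F * nrm (bidual B) G"
      unfolding bs(1-3)
      by (intro D.nrm_dual_le[OF closed _ le] mult_nonneg_nonneg D.nrm_dual_nonneg) (auto simp: bs)
  next
    fix F G H assume FG: "F \<in> carrier (bidual B)" "G \<in> carrier (bidual B)" "H \<in> carrier (bidual B)"
    then have c: "F \<in> carrier (dual (dual B))" "G \<in> carrier (dual (dual B))" "H \<in> carrier (dual (dual B))"
      by (simp_all add: bs(1))
    show "mul (bidual B) (mul (bidual B) F G) H = mul (bidual B) F (mul (bidual B) G H)"
    proof (rule ext)
      fix f show "mul (bidual B) (mul (bidual B) F G) H f = mul (bidual B) F (mul (bidual B) G H) f"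
      proof (cases "f \<in> carrier (dual B)")
        case True
        have "mul (bidual B) (mul (bidual B) F G) H f = mul (bidual B) F G (arens_act B H f)"
          using True by (simp only: mul_eq if_True)
        also have "\<dots> = F (arens_act B G (arens_act B H f))"
          using arens_act_dual(1)[OF c(3) True] by (simp only: mul_eq if_True)
        also have "\<dots> = mul (bidual B) F (mul (bidual B) G H) f"
          using True by (simp only: mul_eq[of F] if_True act_mul[OF c(2,3) True])
        finally show ?thesis .
      qed (simp only: mul_eq if_False)
    qed
    show "mul (bidual B) (F + G) H = mul (bidual B) F H + mul (bidual B) G H"
      by (rule ext) (simp add: mul_eq)
    show "mul (bidual B) F (G + H) = mul (bidual B) F G + mul (bidual B) F H"
      using c by (intro ext) (simp add: mul_eq act_add_left D.dual_add arens_act_dual(1))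
  next
    fix F G c assume "F \<in> carrier (bidual B)" "G \<in> carrier (bidual B)"
    then have FG: "F \<in> carrier (dual (dual B))" "G \<in> carrier (dual (dual B))"
      by (simp_all add: bs(1))
    then show "mul (bidual B) F G \<in> carrier (bidual B)"
      using closed by (simp only: bs(1))
    show "mul (bidual B) (smul (bidual B) c F) G = smul (bidual B) c (mul (bidual B) F G)"
      by (rule ext) (simp add: mul_eq bs(2) D.smul_dual)
    show "mul (bidual B) F (smul (bidual B) c G) = smul (bidual B) c (mul (bidual B) F G)"
    proof (rule ext)
      fix f show "mul (bidual B) F (smul (bidual B) c G) f = smul (bidual B) c (mul (bidual B) F G) f"
        using FG by (cases "f \<in> carrier (dual B)")
          (simp_all add: mul_eq bs(2) act_smul_left D.dual_smul arens_act_dual(1) D.smul_dual[of c "mul (bidual B) F G"])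
    qed
  qed
qed


lemma isometric_isomorphism_banach_algebra:
  fixes C :: "('k::{real_normed_field,banach}, 'w::ab_group_add, 'l) nalgebra_scheme"
  assumes "banach_algebra B" and iso: "isometric_isomorphism B C \<phi>"
  shows "banach_algebra C"
proof -
  interpret banach_algebra B by fact
  have im: "\<exists>x\<in>carrier B. y = \<phi> x" if "y \<in> carrier C" for y
    using iso that by (auto simp: isometric_isomorphism_def bij_betw_def)
  have inj: "\<phi> x = \<phi> y \<longleftrightarrow> x = y" if "x \<in> carrier B" "y \<in> carrier B" for x y
    using iso that by (auto simp: isometric_isomorphism_def bij_betw_def inj_on_def)
  have cl: "\<phi> x \<in> carrier C" if "x \<in> carrier B" for x
    using iso that by (auto simp: isometric_isomorphism_def bij_betw_def)
  have add: "\<phi> x + \<phi> y = \<phi> (x + y)" and mul: "mul C (\<phi> x) (\<phi> y) = \<phi> (mul B x y)"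
    if "x \<in> carrier B" "y \<in> carrier B" for x y
    using iso that by (auto simp: isometric_isomorphism_def)
  have sm: "smul C c (\<phi> x) = \<phi> (smul B c x)" and nr: "nrm C (\<phi> x) = nrm B x" if "x \<in> carrier B" for x c
    using iso that by (auto simp: isometric_isomorphism_def)
  have zero: "\<phi> 0 = 0"
    using add[OF zero_closed zero_closed] by simp
  have diff: "\<phi> x - \<phi> y = \<phi> (x - y)" if "x \<in> carrier B" "y \<in> carrier B" for x y
    using add[OF diff_closed[OF that] that(2)] by (simp add: algebra_simps)
  note cs = zero_closed add_closed smul_closed mul_closed
  show ?thesis
  proof
    show "0 \<in> carrier C" using cl[OF zero_closed] zero by simp
  next
    fix x assume "x \<in> carrier C"
    then obtain x' where x: "x' \<in> carrier B" "x = \<phi> x'" using im by blast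
    show "smul C 1 x = x" using x by (simp add: sm smul_one)
    show "nrm C x = 0 \<longleftrightarrow> x = 0"
      using x nrm_eq_zero_iff[OF x(1)] inj[OF x(1) zero_closed] zero by (simp add: nr)
    fix c d
    show "smul C c x \<in> carrier C" "nrm C (smul C c x) = norm c * nrm C x"
      using x by (simp_all add: sm nr nrm_smul cl cs)
    show "smul C (c + d) x = smul C c x + smul C d x" "smul C c (smul C d x) = smul C (c * d) x"
      using x by (simp_all add: sm add smul_add_left smul_smul cs)
  next
    fix x y assume "x \<in> carrier C" "y \<in> carrier C"
    then obtain x' y' where x: "x' \<in> carrier B" "x = \<phi> x'" "y' \<in> carrier B" "y = \<phi> y'" using im by blast
    show "x + y \<in> carrier C" "mul C x y \<in> carrier C"
      "nrm C (x + y) \<le> nrm C x + nrm C y" "nrm C (mul C x y) \<le> nrm C x * nrm C y"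
      using x by (simp_all add: add mul nr nrm_triangle nrm_mul cl cs)
    fix c
    show "smul C c (x + y) = smul C c x + smul C c y"
      using x sm[OF add_closed[OF x(1,3)], of c] smul_add_right[OF x(1,3), of c]
        add[OF smul_closed[OF x(1)] smul_closed[OF x(3)], of c c] by (simp add: add sm)
    show "mul C (smul C c x) y = smul C c (mul C x y)"
      using mul_smul_left[OF x(1,3), of c] by (simp only: x(2,4) sm[OF x(1)] mul[OF smul_closed[OF x(1)] x(3)]
          mul[OF x(1,3)] sm[OF mul_closed[OF x(1,3)]])
    show "mul C x (smul C c y) = smul C c (mul C x y)"
      using mul_smul_right[OF x(1,3), of c] by (simp only: x(2,4) sm[OF x(3)] mul[OF x(1) smul_closed[OF x(3)]]
          mul[OF x(1,3)] sm[OF mul_closed[OF x(1,3)]])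
  next
    fix x y z assume "x \<in> carrier C" "y \<in> carrier C" "z \<in> carrier C"
    then obtain x' y' z' where x: "x' \<in> carrier B" "x = \<phi> x'" "y' \<in> carrier B" "y = \<phi> y'"
        "z' \<in> carrier B" "z = \<phi> z'" using im[of x] im[of y] im[of z] by auto
    show "mul C (x + y) z = mul C x z + mul C y z" "mul C x (y + z) = mul C x y + mul C x z"
      "mul C (mul C x y) z = mul C x (mul C y z)"
      using x by (simp_all add: add mul mul_add_left mul_add_right mul_assoc cs)
  next
    fix \<sigma> :: "nat \<Rightarrow> 'w"
    assume s: "\<And>i. \<sigma> i \<in> carrier C"
      and C: "\<And>e. e > 0 \<Longrightarrow> \<exists>N. \<forall>i\<ge>N. \<forall>j\<ge>N. nrm C (\<sigma> i - \<sigma> j) < e"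
    have "\<forall>i. \<exists>x. x \<in> carrier B \<and> \<sigma> i = \<phi> x" using im[OF s] by blast
    then obtain \<tau> where "\<forall>i. \<tau> i \<in> carrier B \<and> \<sigma> i = \<phi> (\<tau> i)" by (rule choice[THEN exE])
    then have t: "\<tau> i \<in> carrier B" "\<sigma> i = \<phi> (\<tau> i)" for i by auto
    have eq: "nrm C (\<sigma> i - \<phi> x) = nrm B (\<tau> i - x)" if "x \<in> carrier B" for i x
      using diff[OF t(1) that] nr[OF diff_closed[OF t(1) that]] by (simp only: t(2))
    obtain x where x: "x \<in> carrier B" "(\<lambda>i. nrm B (\<tau> i - x)) \<longlonglongrightarrow> 0"
    proof -
      have "\<exists>x\<in>carrier B. (\<lambda>i. nrm B (\<tau> i - x)) \<longlonglongrightarrow> 0"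
      proof (rule complete[of \<tau>])
        fix e :: real assume "e > 0"
        then obtain N where "\<forall>i\<ge>N. \<forall>j\<ge>N. nrm C (\<sigma> i - \<sigma> j) < e" using C[of e] by blast
        moreover have "nrm C (\<sigma> i - \<sigma> j) = nrm B (\<tau> i - \<tau> j)" for i j
          using eq[OF t(1), of i j] by (simp only: t(2))
        ultimately show "\<exists>N. \<forall>i\<ge>N. \<forall>j\<ge>N. nrm B (\<tau> i - \<tau> j) < e" by (intro exI[of _ N]) simp
      qed (rule t(1))
      then show ?thesis by (elim bexE) (rule that)
    qed
    have "(\<lambda>i. nrm C (\<sigma> i - \<phi> x)) \<longlonglongrightarrow> 0" using x(2) by (simp only: eq[OF x(1)])
    then show "\<exists>x\<in>carrier C. (\<lambda>i. nrm C (\<sigma> i - x)) \<longlonglongrightarrow> 0" by (rule bexI) (rule cl[OF x(1)])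
  qed
qed

theorem even_dual_banach_algebra:
  assumes "banach_algebra A" "even_dual A n B"
  shows "banach_algebra B"
  using assms(2)
proof (induction rule: even_dual.induct)
  case (base B \<phi>)
  show ?case by (rule isometric_isomorphism_banach_algebra[OF assms(1) base(1)])
next
  case (step n B C \<phi>)
  show ?case
    by (rule isometric_isomorphism_banach_algebra[OF banach_algebra.banach_algebra_bidual step.hyps(2)])
       (rule step.IH)
qed

end

theory Submission
  imports Defs
begin

text \<open>
  Write \<open>B\<close> for the Banach algebra \<open>A\<^sup>(\<^sup>n\<^sup>)\<close>.  Let \<open>D : B \<rightarrow> B\<^sup>*\<close> be
  a \<open>T\<close>-\<open>S\<close>-derivation.  The idea is to pass to the second adjoint
  \<open>D'' : B\<^sup>*\<^sup>* \<rightarrow> B\<^sup>*\<^sup>*\<^sup>*\<close>, to show that it is a \<open>T''\<close>-\<open>S''\<close>-derivation (\<open>derivation_adjoint2\<close>), and to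
  restrict an element of \<open>B\<^sup>*\<^sup>*\<^sup>*\<close> that implements \<open>D''\<close> to the canonical image of \<open>B\<close>; because the
  second adjoints extend \<open>D\<close>, \<open>T\<close> and \<open>S\<close>, the restriction implements \<open>D\<close>
  (\<open>weakly_amenable_of_bidual\<close>).

  For \<open>F, G, X\<close> in \<open>B\<^sup>*\<^sup>*\<close> the derivation identity for \<open>D''\<close> reads
  \<open>D''(F G)(X) = D''(G)(X T''(F)) + D''(F)(S''(G) X)\<close>.  The left side arises by
  applying \<open>X\<close> to \<open>D(a b)\<close>, then \<open>G\<close> in the variable \<open>b\<close>, then \<open>F\<close> in the variable \<open>a\<close>.  The
  summand \<open>D(a) S(b)\<close> yields \<open>D''(F)(S''(G) X)\<close> by the definition of the first Arens
  product.  The summand \<open>T(a) D(b)\<close> yields \<open>F\<close> applied to the functional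
  \<open>a \<mapsto> D''(G)(X T(a))\<close> on \<open>B\<close>, and replacing \<open>a\<close> by \<open>F\<close> inside it is a weak-star limit: it is
  legitimate when \<open>H \<mapsto> D''(G)(X T''(H))\<close> is weak-star continuous on \<open>B\<^sup>*\<^sup>*\<close>, which is
  what the \<open>T\<close>-\<open>w\<^sup>*w\<close> property gives.  No nets are used: a weak-star continuous functional on a
  dual is an evaluation (\<open>weak_star_continuous_functional\<close>), so there is one \<open>f \<in> B\<^sup>*\<close> with
  \<open>D''(G)(X T''(H)) = H(f)\<close> for all \<open>H\<close> (\<open>wstar_w_representation\<close>), and this is read once with \<open>H\<close>
  in \<open>B\<close> and once with \<open>H = F\<close>.
\<close>

section \<open>Adjoints and the canonical embedding\<close>

lemma dual_cong:
  assumes "carrier Y = carrier X" "smul Y = smul X" "nrm Y = nrm X"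
  shows "dual Y = dual X"
  using assms by (simp add: dual_def bounded_linear_map_def)

lemma bounded_linear_map_nonneg_bound:
  assumes "banach_space X" "bounded_linear_map X Y T"
  obtains K where "0 \<le> K" "\<And>x. x \<in> carrier X \<Longrightarrow> nrm Y (T x) \<le> K * nrm X x"
proof -
  obtain K where K: "\<And>x. x \<in> carrier X \<Longrightarrow> nrm Y (T x) \<le> K * nrm X x"
    using assms(2) unfolding bounded_linear_map_def by blast
  show thesis
  proof (rule that[of "\<bar>K\<bar>"])
    fix x assume x: "x \<in> carrier X"
    have "K * nrm X x \<le> \<bar>K\<bar> * nrm X x"
      using banach_space.nrm_nonneg[OF assms(1) x] by (intro mult_right_mono) auto
    then show "nrm Y (T x) \<le> \<bar>K\<bar> * nrm X x" using K[OF x] by linarith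
  qed simp
qed

lemma bounded_linear_map_adjoint:
  assumes X: "banach_space X" and Y: "banach_space Y" and T: "bounded_linear_map X Y T"
  shows "bounded_linear_map (dual Y) (dual X) (adjoint X Y T)"
proof -
  interpret X: banach_space X by fact
  interpret Y: banach_space Y by fact
  interpret DY: banach_space "dual Y" by (rule Y.banach_space_dual)
  obtain K where K: "0 \<le> K" "\<And>x. x \<in> carrier X \<Longrightarrow> nrm Y (T x) \<le> K * nrm X x"
    using bounded_linear_map_nonneg_bound[OF X T] by blast
  have T_in: "T x \<in> carrier Y" if "x \<in> carrier X" for x
    using T that by (simp add: bounded_linear_map_def)
  have T_lin: "T (x + y) = T x + T y" "T (smul X c x) = smul Y c (T x)"
    if "x \<in> carrier X" "y \<in> carrier X" for x y c
    using T that by (simp_all add: bounded_linear_map_def)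
  have le: "norm (adjoint X Y T g x) \<le> (K * nrm (dual Y) g) * nrm X x"
    if g: "g \<in> carrier (dual Y)" and x: "x \<in> carrier X" for g x
  proof -
    have "norm (g (T x)) \<le> nrm (dual Y) g * nrm Y (T x)"
      by (rule Y.norm_dual_le[OF g T_in[OF x]])
    also have "\<dots> \<le> nrm (dual Y) g * (K * nrm X x)"
      by (rule mult_left_mono[OF K(2)[OF x] Y.nrm_dual_nonneg[OF g]])
    finally show ?thesis using g x by (simp add: adjoint_def mult_ac)
  qed
  have closed: "adjoint X Y T g \<in> carrier (dual X)" if g: "g \<in> carrier (dual Y)" for g
    by (rule X.dualI[OF _ _ le[OF g]])
       (use g T_in T_lin in \<open>auto simp: adjoint_def X.add_closed X.smul_closed Y.dual_add Y.dual_smul\<close>)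
  have "nrm (dual X) (adjoint X Y T g) \<le> K * nrm (dual Y) g" if g: "g \<in> carrier (dual Y)" for g
    by (rule X.nrm_dual_le[OF closed[OF g] _ le[OF g]]) (use K Y.nrm_dual_nonneg[OF g] in auto)
  moreover have "adjoint X Y T (g + h) = adjoint X Y T g + adjoint X Y T h"
    "adjoint X Y T (smul (dual Y) c g) = smul (dual X) c (adjoint X Y T g)"
    if "g \<in> carrier (dual Y)" "h \<in> carrier (dual Y)" for g h c
    using that DY.add_closed[OF that] DY.smul_closed[OF that(1), of c]
    by (auto simp: adjoint_def fun_eq_iff X.smul_dual Y.smul_dual)
  ultimately show ?thesis
    unfolding bounded_linear_map_def using closed by blast
qed

lemma bounded_linear_map_adjoint2:
  assumes "banach_space X" "banach_space Y" "bounded_linear_map X Y T"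
  shows "bounded_linear_map (dual (dual X)) (dual (dual Y)) (adjoint2 X Y T)"
  unfolding adjoint2_def
  by (intro bounded_linear_map_adjoint banach_space.banach_space_dual assms)

definition canonical_embedding ::
    "('k::{real_normed_field,banach}, 'v::ab_group_add, 'm) nspace_scheme \<Rightarrow> 'v \<Rightarrow> ('v \<Rightarrow> 'k) \<Rightarrow> 'k"
  where "canonical_embedding X x = (\<lambda>f. if f \<in> carrier (dual X) then f x else 0)"

lemma bounded_linear_map_canonical_embedding:
  assumes "banach_space X"
  shows "bounded_linear_map X (dual (dual X)) (canonical_embedding X)"
proof -
  interpret banach_space X by fact
  interpret D: banach_space "dual X" by (rule banach_space_dual)
  have le: "norm (canonical_embedding X x f) \<le> nrm X x * nrm (dual X) f"
    if "x \<in> carrier X" "f \<in> carrier (dual X)" for x f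
    using that norm_dual_le[OF that(2,1)] by (simp add: canonical_embedding_def mult_ac)
  have closed: "canonical_embedding X x \<in> carrier (dual (dual X))" if x: "x \<in> carrier X" for x
    by (rule D.dualI[OF _ _ le[OF x]])
       (use x D.add_closed D.smul_closed in \<open>auto simp: canonical_embedding_def smul_dual\<close>)
  have "nrm (dual (dual X)) (canonical_embedding X x) \<le> 1 * nrm X x" if x: "x \<in> carrier X" for x
    by (rule D.nrm_dual_le[OF closed[OF x]]) (use x le nrm_nonneg in auto)
  moreover have "canonical_embedding X (x + y) = canonical_embedding X x + canonical_embedding X y"
    "canonical_embedding X (smul X c x) = smul (dual (dual X)) c (canonical_embedding X x)"
    if "x \<in> carrier X" "y \<in> carrier X" for x y c
    using that by (auto simp: canonical_embedding_def fun_eq_iff D.smul_dual dual_add dual_smul)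
  ultimately show ?thesis
    unfolding bounded_linear_map_def using closed by blast
qed

text \<open>The second adjoint extends the map, which is what lets statements on the bidual descend.\<close>

lemma adjoint2_canonical_embedding:
  assumes X: "banach_space X" and Y: "banach_space Y" and T: "bounded_linear_map X Y T"
    and x: "x \<in> carrier X"
  shows "adjoint2 X Y T (canonical_embedding X x) = canonical_embedding Y (T x)"
proof
  fix g
  have "canonical_embedding X x \<in> carrier (dual (dual X))"
    using bounded_linear_map_canonical_embedding[OF X] x by (simp add: bounded_linear_map_def)
  then have "adjoint2 X Y T (canonical_embedding X x) g =
      (if g \<in> carrier (dual Y) then canonical_embedding X x (adjoint X Y T g) else 0)"
    by (simp add: adjoint2_def adjoint_def[of "dual Y"])
  moreover have "adjoint X Y T g \<in> carrier (dual X)" if "g \<in> carrier (dual Y)"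
    using bounded_linear_map_adjoint[OF X Y T] that by (simp add: bounded_linear_map_def)
  moreover have "adjoint X Y T g x = g (T x)" if "g \<in> carrier (dual Y)"
    using that x by (simp add: adjoint_def)
  ultimately show "adjoint2 X Y T (canonical_embedding X x) g = canonical_embedding Y (T x) g"
    by (simp add: canonical_embedding_def)
qed

section \<open>Weak-star continuous functionals are evaluations\<close>

lemma topspace_initial_topology:
  assumes "\<phi> \<in> \<Phi>"
  shows "topspace (initial_topology V \<Phi>) = V"
proof -
  have "{v \<in> V. \<phi> v \<in> UNIV} \<in> {{v \<in> V. \<phi> v \<in> U} |\<phi> U. \<phi> \<in> \<Phi> \<and> open U}"
    using assms open_UNIV by blast
  then show ?thesis
    unfolding initial_topology_def topology_generated_by_topspace by auto
qed

text \<open>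
  Basic neighbourhoods constrain only finitely many of the functions.  Recording the points that
  agree with \<open>v\<close> under those functions is enough below, and makes radii superfluous.
\<close>

lemma openin_initial_topology_agreement:
  assumes "openin (initial_topology V \<Phi>) W" and "v \<in> W"
  shows "\<exists>F. finite F \<and> F \<subseteq> \<Phi> \<and> {w \<in> V. \<forall>\<phi>\<in>F. \<phi> w = \<phi> v} \<subseteq> W"
proof -
  have "generate_topology_on {{v \<in> V. \<phi> v \<in> U} |\<phi> U. \<phi> \<in> \<Phi> \<and> open U} W"
    using assms(1) by (simp add: initial_topology_def openin_topology_generated_by)
  then show ?thesis using assms(2)
  proof (induction rule: generate_topology_on.induct)
    case (Int W1 W2)
    then have "v \<in> W1" "v \<in> W2" by auto
    from Int.IH(1)[OF this(1)] obtain F1 where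
      F1: "finite F1" "F1 \<subseteq> \<Phi>" "{w \<in> V. \<forall>\<phi>\<in>F1. \<phi> w = \<phi> v} \<subseteq> W1"
      by blast
    from Int.IH(2)[OF \<open>v \<in> W2\<close>] obtain F2 where
      F2: "finite F2" "F2 \<subseteq> \<Phi>" "{w \<in> V. \<forall>\<phi>\<in>F2. \<phi> w = \<phi> v} \<subseteq> W2"
      by blast
    have "{w \<in> V. \<forall>\<phi>\<in>F1 \<union> F2. \<phi> w = \<phi> v} \<subseteq> W1 \<inter> W2" using F1(3) F2(3) by auto
    then show ?case using F1(1,2) F2(1,2) by (intro exI[of _ "F1 \<union> F2"]) simp
  next
    case (UN K)
    then obtain k where "k \<in> K" "v \<in> k" by blast
    from UN.IH[OF this] obtain F where
      "finite F" "F \<subseteq> \<Phi>" "{w \<in> V. \<forall>\<phi>\<in>F. \<phi> w = \<phi> v} \<subseteq> k"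
      by blast
    then show ?case using \<open>k \<in> K\<close> by blast
  next
    case (Basis s)
    then obtain \<phi> U where "s = {v \<in> V. \<phi> v \<in> U}" "\<phi> \<in> \<Phi>" by blast
    then show ?case using Basis.prems by (intro exI[of _ "{\<phi>}"]) auto
  qed simp
qed

lemma continuous_map_initial_topology:
  assumes "\<phi> \<in> \<Phi>"
  shows "continuous_map (initial_topology V \<Phi>) euclidean \<phi>"
proof -
  have "openin (initial_topology V \<Phi>) {v \<in> V. \<phi> v \<in> U}" if "open U" for U
    unfolding initial_topology_def
    by (rule topology_generated_by_Basis) (use assms that in blast)
  then show ?thesis
    by (simp add: continuous_map_def topspace_initial_topology[OF assms])
qed

context banach_space begin

text \<open>
  The linear algebra fact that a functional vanishing on a finite intersection of kernels is a
  linear combination of the functionals concerned, here for evaluations at points of the space;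
  a linear combination of evaluations is the evaluation at a linear combination.
\<close>

lemma functional_vanishing_on_common_kernel:
  assumes "finite F" "F \<subseteq> carrier X"
    and "\<And>G H. \<lbrakk>G \<in> carrier (dual X); H \<in> carrier (dual X)\<rbrakk> \<Longrightarrow> \<phi> (G + H) = \<phi> G + \<phi> H"
    and "\<And>c G. G \<in> carrier (dual X) \<Longrightarrow> \<phi> (smul (dual X) c G) = c * \<phi> G"
    and "\<And>G. \<lbrakk>G \<in> carrier (dual X); \<forall>x\<in>F. G x = 0\<rbrakk> \<Longrightarrow> \<phi> G = 0"
  shows "\<exists>x\<in>carrier X. \<forall>G\<in>carrier (dual X). \<phi> G = G x"
  using assms
proof (induction F arbitrary: \<phi> rule: finite_induct)
  case empty
  have "0 \<in> carrier X" by (rule zero_closed)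
  moreover have "G 0 = 0" if "G \<in> carrier (dual X)" for G
    using dual_add[OF that zero_closed zero_closed] by simp
  ultimately show ?case using empty.prems(4) by auto
next
  case (insert x F)
  show ?case
  proof (cases "\<exists>G0\<in>carrier (dual X). (\<forall>y\<in>F. G0 y = 0) \<and> G0 x \<noteq> 0")
    case False
    show ?thesis
    proof (rule insert.IH)
      fix G assume "G \<in> carrier (dual X)" "\<forall>y\<in>F. G y = 0"
      then show "\<phi> G = 0" using False by (intro insert.prems(4)) auto
    qed (use insert.prems(1-3) in simp_all)
  next
    case True
    then obtain G0 where G0: "G0 \<in> carrier (dual X)" "\<forall>y\<in>F. G0 y = 0" "G0 x \<noteq> 0" by blast
    \<comment> \<open>The coefficient of the evaluation at \<open>x\<close> is forced by the value at \<open>G0\<close>, which spans the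
      common kernel of \<open>F\<close> modulo that of \<open>insert x F\<close>.\<close>
    define c where "c = \<phi> G0 / G0 x"
    have "\<exists>y\<in>carrier X. \<forall>G\<in>carrier (dual X). \<phi> G - c * G x = G y"
    proof (rule insert.IH)
      fix G assume G: "G \<in> carrier (dual X)" "\<forall>y\<in>F. G y = 0"
      define s where "s = - (G x / G0 x)"
      have sG0: "smul (dual X) s G0 \<in> carrier (dual X)" by (rule dual_smul_closed[OF G0(1)])
      have "\<phi> (G + smul (dual X) s G0) = 0"
      proof (rule insert.prems(4)[OF dual_add_closed[OF G(1) sG0]])
        show "\<forall>y\<in>insert x F. (G + smul (dual X) s G0) y = 0"
          using G(2) G0(2,3) by (simp add: smul_dual s_def)
      qed
      then have "\<phi> G + s * \<phi> G0 = 0"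
        using insert.prems(2)[OF G(1) sG0] insert.prems(3)[OF G0(1)] by simp
      then show "\<phi> G - c * G x = 0" by (simp add: s_def c_def)
    next
      show "F \<subseteq> carrier X" using insert.prems(1) by simp
      fix G assume G: "G \<in> carrier (dual X)"
      show "\<phi> (smul (dual X) d G) - c * smul (dual X) d G x = d * (\<phi> G - c * G x)" for d
        using insert.prems(3)[OF G, of d] by (simp add: smul_dual algebra_simps)
      fix H assume H: "H \<in> carrier (dual X)"
      show "\<phi> (G + H) - c * (G + H) x = \<phi> G - c * G x + (\<phi> H - c * H x)"
        unfolding insert.prems(2)[OF G H] by (simp add: algebra_simps)
    qed
    then obtain y where y: "y \<in> carrier X" "\<And>G. G \<in> carrier (dual X) \<Longrightarrow> \<phi> G - c * G x = G y"
      by blast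
    have x: "x \<in> carrier X" using insert.prems(1) by simp
    show ?thesis
    proof (intro bexI ballI)
      fix G assume G: "G \<in> carrier (dual X)"
      show "\<phi> G = G (y + smul X c x)"
        using y(2)[OF G] dual_add[OF G y(1) smul_closed[OF x]] dual_smul[OF G x]
        by (simp add: algebra_simps)
    qed (intro add_closed smul_closed x y)
  qed
qed

text \<open>
  Continuity at \<open>0\<close> bounds \<open>\<phi>\<close> by \<open>1\<close> on the common kernel of finitely many evaluations; that
  kernel is closed under scaling, so \<open>\<phi>\<close> vanishes on it.
\<close>

lemma weak_star_continuous_functional:
  assumes add: "\<And>G H. \<lbrakk>G \<in> carrier (dual X); H \<in> carrier (dual X)\<rbrakk> \<Longrightarrow> \<phi> (G + H) = \<phi> G + \<phi> H"
    and smul: "\<And>c G. G \<in> carrier (dual X) \<Longrightarrow> \<phi> (smul (dual X) c G) = c * \<phi> G"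
    and cont: "continuous_map (weak_star_topology X) euclidean \<phi>"
  shows "\<exists>x\<in>carrier X. \<forall>G\<in>carrier (dual X). \<phi> G = G x"
proof -
  have top: "topspace (weak_star_topology X) = carrier (dual X)"
    unfolding weak_star_topology_def by (rule topspace_initial_topology) (use zero_closed in blast)
  have "\<phi> 0 = 0" using add[OF dual_zero_closed dual_zero_closed] by simp
  then have 0: "0 \<in> {G \<in> carrier (dual X). \<phi> G \<in> ball 0 1}" using dual_zero_closed by simp
  have "openin (weak_star_topology X) {G \<in> carrier (dual X). \<phi> G \<in> ball 0 1}"
    using openin_continuous_map_preimage[OF cont, of "ball 0 1"] by (simp add: top)
  from openin_initial_topology_agreement[OF this[unfolded weak_star_topology_def] 0]
  obtain E where E: "finite E" "E \<subseteq> (\<lambda>x f. f x) ` carrier X"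
    "{G \<in> carrier (dual X). \<forall>e\<in>E. e G = e 0} \<subseteq> {G \<in> carrier (dual X). \<phi> G \<in> ball 0 1}"
    by blast
  from finite_subset_image[OF E(1,2)] obtain F where
    F: "F \<subseteq> carrier X" "finite F" "E = (\<lambda>x f. f x) ` F" by blast
  show ?thesis
  proof (rule functional_vanishing_on_common_kernel[OF F(2,1) add smul])
    fix G assume G: "G \<in> carrier (dual X)" "\<forall>x\<in>F. G x = 0"
    show "\<phi> G = 0"
    proof (rule ccontr)
      assume nz: "\<phi> G \<noteq> 0"
      have "smul (dual X) (inverse (\<phi> G)) G \<in> {G \<in> carrier (dual X). \<forall>e\<in>E. e G = e 0}"
        using G dual_smul_closed[OF G(1)] by (auto simp: F(3) smul_dual)
      then have "norm (\<phi> (smul (dual X) (inverse (\<phi> G)) G)) < 1"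
        using E(3) by auto
      then show False using nz smul[OF G(1), of "inverse (\<phi> G)"] by simp
    qed
  qed
qed

end

section \<open>The second adjoint of a derivation\<close>

context banach_algebra begin

lemma banach_space_dual_bimodule: "banach_space (dual_bimodule B)"
  by (rule banach_space_cong[OF banach_space_dual]) (simp_all add: dual_bimodule_simps)

lemma dual_dual_bimodule: "dual (dual_bimodule B) = dual (dual B)"
  by (rule dual_cong) (simp_all add: dual_bimodule_simps)

lemma dual_bidual: "dual (bidual B) = dual (dual (dual B))"
  by (rule dual_cong) (simp_all add: bidual_def)

lemma carrier_bidual: "carrier (bidual B) = carrier (dual (dual B))"
  by (simp add: bidual_def)

lemma mul_bidual:
  "f \<in> carrier (dual B) \<Longrightarrow> mul (bidual B) F G f = F (arens_act B G f)"
  by (simp add: bidual_def)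

text \<open>The form in which the \<open>T\<close>-\<open>w\<^sup>*w\<close> property enters the proof.\<close>

lemma wstar_w_representation:
  assumes T: "bounded_linear_map B B T" and w: "wstar_w_property B T"
    and F: "F \<in> carrier (bidual B)" and H: "H \<in> carrier (dual (bidual B))"
  shows "\<exists>f\<in>carrier (dual B). \<forall>G\<in>carrier (bidual B).
           H (mul (bidual B) F (adjoint2 B B T G)) = G f"
proof -
  interpret D: banach_space "dual B" by (rule banach_space_dual)
  interpret BB: banach_algebra "bidual B" by (rule banach_algebra_bidual)
  have sm: "smul (bidual B) = smul (dual (dual B))" by (simp add: bidual_def)
  have T2: "bounded_linear_map (dual (dual B)) (dual (dual B)) (adjoint2 B B T)"
    by (rule bounded_linear_map_adjoint2[OF banach_space_axioms banach_space_axioms T])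
  have "continuous_map (weak_star_topology (dual B)) (weak_topology (bidual B))
         (\<lambda>G. mul (bidual B) F (adjoint2 B B T G))"
    using w F by (simp add: wstar_w_property_def)
  moreover have "continuous_map (weak_topology (bidual B)) euclidean H"
    unfolding weak_topology_def by (rule continuous_map_initial_topology[OF H])
  ultimately have "continuous_map (weak_star_topology (dual B)) euclidean
      (\<lambda>G. H (mul (bidual B) F (adjoint2 B B T G)))"
    using continuous_map_compose by (fastforce simp: o_def)
  then have "\<exists>f\<in>carrier (dual B). \<forall>G\<in>carrier (dual (dual B)).
      H (mul (bidual B) F (adjoint2 B B T G)) = G f"
  proof (rule D.weak_star_continuous_functional[rotated 2])
    fix G G' assume "G \<in> carrier (dual (dual B))" "G' \<in> carrier (dual (dual B))"
    then show "H (mul (bidual B) F (adjoint2 B B T (G + G'))) =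
        H (mul (bidual B) F (adjoint2 B B T G)) + H (mul (bidual B) F (adjoint2 B B T G'))"
      using T2 F by (simp add: bounded_linear_map_def BB.mul_add_right BB.dual_add[OF H]
          BB.mul_closed carrier_bidual[symmetric])
  next
    fix c G assume "G \<in> carrier (dual (dual B))"
    then show "H (mul (bidual B) F (adjoint2 B B T (smul (dual (dual B)) c G))) =
        c * H (mul (bidual B) F (adjoint2 B B T G))"
      using T2 F by (simp add: bounded_linear_map_def BB.mul_smul_right BB.dual_smul[OF H]
          BB.mul_closed carrier_bidual[symmetric] sm[symmetric])
  qed
  then show ?thesis by (simp add: carrier_bidual)
qed

lemma canonical_embedding_in_bidual:
  "a \<in> carrier B \<Longrightarrow> canonical_embedding B a \<in> carrier (bidual B)"
  using bounded_linear_map_canonical_embedding[OF banach_space_axioms]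
  by (simp add: bounded_linear_map_def carrier_bidual)

text \<open>
  Products in the bidual with one factor from \<open>B\<close> reduce to the module actions on \<open>B\<^sup>*\<close>.
\<close>

lemma mul_bidual_canonical_right:
  assumes "a \<in> carrier B" "f \<in> carrier (dual B)"
  shows "mul (bidual B) F (canonical_embedding B a) f = F (lact (dual_bimodule B) a f)"
proof -
  have "arens_act B (canonical_embedding B a) f = lact (dual_bimodule B) a f"
    using assms ract_dual(1)[OF assms(2)]
    by (simp add: arens_act_def canonical_embedding_def fun_eq_iff) (simp add: dual_bimodule_simps)
  then show ?thesis by (simp add: mul_bidual assms)
qed

lemma mul_bidual_canonical_left:
  assumes "a \<in> carrier B" "f \<in> carrier (dual B)" "F \<in> carrier (bidual B)"
  shows "mul (bidual B) (canonical_embedding B a) F f = F (ract (dual_bimodule B) f a)"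
  using assms arens_act_dual(1)[of F f]
  by (simp add: mul_bidual canonical_embedding_def carrier_bidual) (simp add: arens_act_def)

text \<open>
  Evaluating both sides at \<open>X\<close> reduces the claim to an identity in \<open>B\<^sup>*\<close>,
  \<open>G \<cdot> D'(X) = f + D'(S''(G) X)\<close>, where \<open>G \<cdot> _\<close> is the Arens action and \<open>f\<close> represents the weak-star
  continuous functional \<open>H \<mapsto> D''(G)(X T''(H))\<close>.  The identity comes from the product
  rule for \<open>D\<close>; applying \<open>F\<close> to it gives the derivation identity.
\<close>

lemma derivation_adjoint2:
  assumes T: "bounded_linear_map B B T" and S: "bounded_linear_map B B S"
    and w: "wstar_w_property B T"
    and D: "derivation B (dual_bimodule B) T S D"
  shows "derivation (bidual B) (dual_bimodule (bidual B)) (adjoint2 B B T) (adjoint2 B B S)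
           (adjoint2 B (dual_bimodule B) D)"
proof -
  let ?D2 = "adjoint2 B (dual_bimodule B) D" and ?D1 = "adjoint B (dual_bimodule B) D"
  let ?T2 = "adjoint2 B B T" and ?S2 = "adjoint2 B B S"
  interpret Du: banach_space "dual B" by (rule banach_space_dual)
  interpret BB: banach_algebra "bidual B" by (rule banach_algebra_bidual)
  have Dlin: "bounded_linear_map B (dual_bimodule B) D"
    and Dmul: "\<And>a b. \<lbrakk>a \<in> carrier B; b \<in> carrier B\<rbrakk> \<Longrightarrow>
      D (mul B a b) = lact (dual_bimodule B) (T a) (D b) + ract (dual_bimodule B) (D a) (S b)"
    using D by (simp_all add: derivation_def)
  have D_in: "D a \<in> carrier (dual B)" and T_in: "T a \<in> carrier B" and S_in: "S a \<in> carrier B"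
    if "a \<in> carrier B" for a
    using that Dlin T S by (simp_all add: bounded_linear_map_def dual_bimodule_simps)
  note D1lin = bounded_linear_map_adjoint[OF banach_space_axioms banach_space_dual_bimodule Dlin,
      unfolded dual_dual_bimodule]
  have D1_in: "?D1 X \<in> carrier (dual B)" if "X \<in> carrier (bidual B)" for X
    using D1lin that by (simp add: bounded_linear_map_def carrier_bidual)
  have D1: "?D1 X a = X (D a)" if "X \<in> carrier (bidual B)" "a \<in> carrier B" for X a
    using that by (simp add: adjoint_def dual_dual_bimodule carrier_bidual)
  have D2: "?D2 F X = F (?D1 X)" if "F \<in> carrier (bidual B)" "X \<in> carrier (bidual B)" for F X
    using that unfolding adjoint2_def dual_dual_bimodule
    by (simp add: adjoint_def[of "dual (dual B)"] carrier_bidual)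
  note D2lin = bounded_linear_map_adjoint2[OF banach_space_axioms banach_space_dual_bimodule Dlin,
      unfolded dual_dual_bimodule]
  have D2_in: "?D2 F \<in> carrier (dual (bidual B))" if "F \<in> carrier (bidual B)" for F
    using D2lin that by (simp add: bounded_linear_map_def carrier_bidual dual_bidual)
  have T2_in: "?T2 F \<in> carrier (bidual B)" and S2_in: "?S2 F \<in> carrier (bidual B)"
    if "F \<in> carrier (bidual B)" for F
    using that bounded_linear_map_adjoint2[OF banach_space_axioms banach_space_axioms T]
      bounded_linear_map_adjoint2[OF banach_space_axioms banach_space_axioms S]
    by (simp_all add: bounded_linear_map_def carrier_bidual)
  have "bounded_linear_map (bidual B) (dual_bimodule (bidual B)) ?D2"
    using D2lin by (simp add: bounded_linear_map_def BB.dual_bimodule_simps dual_bidual)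
       (simp add: bidual_def)
  moreover have "?D2 (mul (bidual B) F G) =
      lact (dual_bimodule (bidual B)) (?T2 F) (?D2 G) + ract (dual_bimodule (bidual B)) (?D2 F) (?S2 G)"
    (is "_ = ?R")
    if F: "F \<in> carrier (bidual B)" and G: "G \<in> carrier (bidual B)" for F G
  proof (rule BB.dual_eqI)
    show "?D2 (mul (bidual B) F G) \<in> carrier (dual (bidual B))"
      by (intro D2_in BB.mul_closed F G)
    show "?R \<in> carrier (dual (bidual B))"
      by (intro BB.dual_add_closed BB.lact_dual(1) BB.ract_dual(1) D2_in T2_in S2_in F G)
    fix X assume X: "X \<in> carrier (bidual B)"
    obtain f where f: "f \<in> carrier (dual B)"
      "\<And>H. H \<in> carrier (bidual B) \<Longrightarrow> ?D2 G (mul (bidual B) X (?T2 H)) = H f"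
      using wstar_w_representation[OF T w X D2_in[OF G]] by blast
    have SX: "mul (bidual B) (?S2 G) X \<in> carrier (bidual B)" by (intro BB.mul_closed S2_in G X)
    have "arens_act B G (?D1 X) = f + ?D1 (mul (bidual B) (?S2 G) X)"
    proof (rule dual_eqI)
      show "arens_act B G (?D1 X) \<in> carrier (dual B)"
        using G D1_in[OF X] by (intro arens_act_dual) (simp_all add: carrier_bidual)
      show "f + ?D1 (mul (bidual B) (?S2 G) X) \<in> carrier (dual B)"
        by (intro dual_add_closed f D1_in SX)
      fix a assume a: "a \<in> carrier B"
      let ?Ta = "canonical_embedding B (T a)"
      have Ta: "?Ta \<in> carrier (bidual B)" by (intro canonical_embedding_in_bidual T_in a)
      have XTa: "mul (bidual B) X ?Ta \<in> carrier (bidual B)" by (intro BB.mul_closed X Ta)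
      have Xd: "arens_act B X (D a) \<in> carrier (dual B)"
        using X D_in[OF a] by (intro arens_act_dual) (simp_all add: carrier_bidual)
      have S1: "adjoint B B S (arens_act B X (D a)) \<in> carrier (dual B)"
        using bounded_linear_map_adjoint[OF banach_space_axioms banach_space_axioms S] Xd
        by (simp add: bounded_linear_map_def)
      \<comment> \<open>the product rule for \<open>D\<close>, tested with \<open>X\<close> and read as an identity of functionals of the
        second factor \<open>b\<close>\<close>
      have split: "ract (dual_bimodule B) (?D1 X) a =
          ?D1 (mul (bidual B) X ?Ta) + adjoint B B S (arens_act B X (D a))"
      proof (rule dual_eqI[OF ract_dual(1)[OF D1_in[OF X] a] dual_add_closed[OF D1_in[OF XTa] S1]])
        fix b assume b: "b \<in> carrier B"
        have "ract (dual_bimodule B) (?D1 X) a b = X (D (mul B a b))"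
          using a b by (simp add: dual_bimodule_simps D1[OF X] mul_closed)
        also have "\<dots> = X (lact (dual_bimodule B) (T a) (D b)) + X (ract (dual_bimodule B) (D a) (S b))"
          unfolding Dmul[OF a b]
          by (rule Du.dual_add[OF X[unfolded carrier_bidual] lact_dual(1) ract_dual(1)])
             (intro D_in T_in S_in a b)+
        also have "X (lact (dual_bimodule B) (T a) (D b)) = ?D1 (mul (bidual B) X ?Ta) b"
          using a b by (simp only: D1[OF XTa] mul_bidual_canonical_right T_in D_in)
        also have "X (ract (dual_bimodule B) (D a) (S b)) = adjoint B B S (arens_act B X (D a)) b"
          using b Xd S_in[OF b] by (simp add: adjoint_def) (simp add: arens_act_def)
        finally show "ract (dual_bimodule B) (?D1 X) a b =
            (?D1 (mul (bidual B) X ?Ta) + adjoint B B S (arens_act B X (D a))) b"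
          by simp
      qed
      have "arens_act B G (?D1 X) a = G (ract (dual_bimodule B) (?D1 X) a)"
        using a by (simp add: arens_act_def)
      also have "\<dots> = G (?D1 (mul (bidual B) X ?Ta)) + G (adjoint B B S (arens_act B X (D a)))"
        unfolding split by (rule Du.dual_add[OF G[unfolded carrier_bidual] D1_in[OF XTa] S1])
      also have "G (?D1 (mul (bidual B) X ?Ta)) = f a"
        using f(2)[OF canonical_embedding_in_bidual[OF a]] D2[OF G XTa] f(1)
        by (simp add: adjoint2_canonical_embedding[OF banach_space_axioms banach_space_axioms T a])
           (simp add: canonical_embedding_def)
      also have "G (adjoint B B S (arens_act B X (D a))) = ?S2 G (arens_act B X (D a))"
        using G Xd by (simp add: adjoint2_def adjoint_def[of "dual B"] carrier_bidual)
      also have "\<dots> = ?D1 (mul (bidual B) (?S2 G) X) a"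
        using D1[OF SX a] by (simp add: mul_bidual D_in a)
      finally show "arens_act B G (?D1 X) a = (f + ?D1 (mul (bidual B) (?S2 G) X)) a"
        by simp
    qed
    then have "?D2 (mul (bidual B) F G) X = F (f + ?D1 (mul (bidual B) (?S2 G) X))"
      using D2[OF BB.mul_closed[OF F G] X] by (simp only: mul_bidual[OF D1_in[OF X]])
    also have "\<dots> = F f + F (?D1 (mul (bidual B) (?S2 G) X))"
      by (rule Du.dual_add[OF F[unfolded carrier_bidual] f(1) D1_in[OF SX]])
    \<comment> \<open>the representation of \<open>f\<close> again, now at \<open>F\<close> instead of at points of \<open>B\<close>\<close>
    also have "\<dots> = ?D2 G (mul (bidual B) X (?T2 F)) + ?D2 F (mul (bidual B) (?S2 G) X)"
      by (simp only: f(2)[OF F] D2[OF F SX])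
    also have "\<dots> = ?R X" using X by (simp add: BB.dual_bimodule_simps)
    finally show "?D2 (mul (bidual B) F G) X = ?R X" .
  qed
  ultimately show ?thesis by (simp add: derivation_def)
qed

text \<open>
  If \<open>x\<close> implements \<open>D''\<close>, then \<open>y = x \<circ> \<iota>\<close> implements \<open>D\<close>: test the equation for
  \<open>D''(\<iota> a)\<close> at \<open>\<iota> c\<close> and use that \<open>\<iota>\<close> is multiplicative and intertwines \<open>T, S\<close> with
  \<open>T'', S''\<close>.
\<close>

theorem weakly_amenable_of_bidual:
  assumes T: "bounded_linear_map B B T" and S: "bounded_linear_map B B S"
    and w: "wstar_w_property B T"
    and wa: "weakly_amenable (bidual B) (adjoint2 B B T) (adjoint2 B B S)"
  shows "weakly_amenable B T S"
  unfolding weakly_amenable_def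
proof (intro allI impI)
  fix D assume D: "derivation B (dual_bimodule B) T S D"
  interpret BB: banach_algebra "bidual B" by (rule banach_algebra_bidual)
  let ?\<iota> = "canonical_embedding B"
  have Dlin: "bounded_linear_map B (dual_bimodule B) D"
    using D by (simp add: derivation_def)
  have D_in: "D a \<in> carrier (dual B)" and T_in: "T a \<in> carrier B" and S_in: "S a \<in> carrier B"
    if "a \<in> carrier B" for a
    using that Dlin T S by (simp_all add: bounded_linear_map_def dual_bimodule_simps)
  note \<iota>_in = canonical_embedding_in_bidual
  obtain x where x: "x \<in> carrier (dual (bidual B))" and
    inner: "\<And>F. F \<in> carrier (bidual B) \<Longrightarrow> adjoint2 B (dual_bimodule B) D F =
       lact (dual_bimodule (bidual B)) (adjoint2 B B T F) x
       - ract (dual_bimodule (bidual B)) x (adjoint2 B B S F)"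
    using wa derivation_adjoint2[OF T S w D]
    by (auto simp: weakly_amenable_def inner_derivation_def BB.dual_bimodule_simps(1))
  define y where "y = (\<lambda>a. if a \<in> carrier B then x (?\<iota> a) else 0)"
  have y: "y \<in> carrier (dual B)"
  proof -
    have "y = adjoint B (bidual B) ?\<iota> x" using x by (auto simp: y_def adjoint_def)
    moreover have "bounded_linear_map B (bidual B) ?\<iota>"
      using bounded_linear_map_canonical_embedding[OF banach_space_axioms]
      by (simp add: bounded_linear_map_def bidual_def)
    ultimately show ?thesis
      using bounded_linear_map_adjoint[OF banach_space_axioms BB.banach_space_axioms] x
      by (simp add: bounded_linear_map_def)
  qed
  have "D a = lact (dual_bimodule B) (T a) y - ract (dual_bimodule B) y (S a)"
    if a: "a \<in> carrier B" for a
  proof (rule dual_eqI[OF D_in[OF a] dual_diff_closed[OF lact_dual(1) ract_dual(1)]])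
    fix c assume c: "c \<in> carrier B"
    have mul_\<iota>: "mul (bidual B) (?\<iota> u) (?\<iota> v) = ?\<iota> (mul B u v)"
      if "u \<in> carrier B" "v \<in> carrier B" for u v
    proof
      fix f show "mul (bidual B) (?\<iota> u) (?\<iota> v) f = ?\<iota> (mul B u v) f"
      proof (cases "f \<in> carrier (dual B)")
        case True
        then show ?thesis
          using that True ract_dual(1)[OF True that(1)]
          unfolding mul_bidual_canonical_left[OF that(1) True \<iota>_in[OF that(2)]]
          by (simp add: canonical_embedding_def) (simp add: dual_bimodule_simps)
      qed (simp add: bidual_def canonical_embedding_def)
    qed
    have "D a c = adjoint B (dual_bimodule B) D (?\<iota> c) a"
      using a c D_in[OF a] \<iota>_in[OF c]
      by (simp add: adjoint_def dual_dual_bimodule carrier_bidual) (simp add: canonical_embedding_def)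
    also have "\<dots> = adjoint2 B (dual_bimodule B) D (?\<iota> a) (?\<iota> c)"
      using D_in[OF a] \<iota>_in[OF c] \<iota>_in[OF a] unfolding
        adjoint2_canonical_embedding[OF banach_space_axioms banach_space_dual_bimodule Dlin a]
      by (simp add: canonical_embedding_def[of "dual_bimodule B"] dual_dual_bimodule carrier_bidual
          adjoint_def a)
    also have "\<dots> = x (mul (bidual B) (?\<iota> c) (?\<iota> (T a))) - x (mul (bidual B) (?\<iota> (S a)) (?\<iota> c))"
      unfolding inner[OF \<iota>_in[OF a]]
        adjoint2_canonical_embedding[OF banach_space_axioms banach_space_axioms T a]
        adjoint2_canonical_embedding[OF banach_space_axioms banach_space_axioms S a]
      using \<iota>_in[OF c] by (simp add: BB.dual_bimodule_simps)
    also have "\<dots> = y (mul B c (T a)) - y (mul B (S a) c)"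
      using a c by (simp add: mul_\<iota> T_in S_in y_def mul_closed)
    finally show "D a c = (lact (dual_bimodule B) (T a) y - ract (dual_bimodule B) y (S a)) c"
      using c by (simp add: dual_bimodule_simps)
  qed (use y T_in S_in a in auto)
  then show "inner_derivation B (dual_bimodule B) T S D"
    using D y by (auto simp: inner_derivation_def dual_bimodule_simps(1))
qed

end

theorem mainTheorem1:
  fixes A :: "('k::{real_normed_field,banach}, 'v::ab_group_add) nalgebra"
    and n :: nat
    and An :: "('k, 'w::ab_group_add) nalgebra"
    and T S :: "'w \<Rightarrow> 'w"
  assumes "banach_algebra A"
    and "even n"
    and "even_dual A n An"
    and "bounded_linear_map An An T"
    and "bounded_linear_map An An S"
    and "wstar_w_property An T"
    and "weakly_amenable (bidual An) (adjoint2 An An T) (adjoint2 An An S)"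
  shows "weakly_amenable An T S"
proof -
  interpret banach_algebra An
    by (rule even_dual_banach_algebra[OF assms(1,3)])
  show ?thesis by (rule weakly_amenable_of_bidual[OF assms(4-7)])
qed

end
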